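(* The set $\overline{\mathcal{E}_3}\cap\overline{\mathcal{F}_3}$ is the set of all unitarily reducible matrices $A\in M_3$ such that $W(A)$ is a point, a segment, or an ellipse with the normal eigenvalue of $A$ on the boundary of $W(A)$.
   Context: $M_3$ is the set of complex $3\times3$ matrices, and closures are taken in the norm topology of $M_3$. The numerical range of $A$ is $W(A)=\{x^*Ax\mid x\in\mathbb{C}^3,\ x^*x=1\}$. $A$ is unitarily reducible if it is unitarily similar to a block diagonal matrix with two proper blocks, and unitarily irreducible otherwise. "Ellipse" here means the closed region (with non-empty interior) bounded by an ellipse in $\mathbb{C}\cong\mathbb{R}^2$; circular disks are included. A flat boundary portion of $W(A)$ is a maximal non-degenerate segment in the boundary of $W(A)$. $\mathcal{E}_3\subset M_3$ is the set of unitarily irreducible matrices whose numerical range is an ellipse; $\mathcal{F}_3\subset M_3$ is the set of unitarily irreducible matrices whose numerical range has a flat boundary portion. A number $\alpha\in\mathbb{C}$ is a normal eigenvalue of $A$ if there is a non-zero vector $x$ with $Ax=\alpha x$ and $A^*x=\overline{\alpha}x$. A unitarily reducible $A\in M_3$ for which $W(A)$ is an ellipse has exactly one normal eigenvalue ("the normal eigenvalue"). *)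

theory Defs
  imports "HOL-Analysis.Analysis"
begin

definition herm_adjoint :: "complex^'n^'m \<Rightarrow> complex^'m^'n" where
  "herm_adjoint A = (\<chi> i j. cnj (A $ j $ i))"

definition unitary_matrix :: "complex^'n^'n \<Rightarrow> bool" where
  "unitary_matrix U \<longleftrightarrow> herm_adjoint U ** U = mat 1 \<and> U ** herm_adjoint U = mat 1"

definition unitarily_similar :: "complex^'n^'n \<Rightarrow> complex^'n^'n \<Rightarrow> bool" where
  "unitarily_similar A B \<longleftrightarrow> (\<exists>U. unitary_matrix U \<and> B = herm_adjoint U ** A ** U)"

text \<open>The library's inner product on \<^typ>\<open>complex^'n\<close> is real-valued, so the complex scalar
  product \<open>x\<^sup>* y\<close> is introduced separately.\<close>

definition cscalar_prod :: "complex^'n \<Rightarrow> complex^'n \<Rightarrow> complex" where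
  "cscalar_prod x y = (\<Sum>i\<in>UNIV. cnj (x $ i) * y $ i)"

definition numerical_range :: "complex^'n^'n \<Rightarrow> complex set" where
  "numerical_range A = {cscalar_prod x (A *v x) | x. cscalar_prod x x = 1}"

definition normal_eigenvalue :: "complex^'n^'n \<Rightarrow> complex \<Rightarrow> bool" where
  "normal_eigenvalue A \<alpha> \<longleftrightarrow>
    (\<exists>x. x \<noteq> 0 \<and> A *v x = \<alpha> *s x \<and> herm_adjoint A *v x = cnj \<alpha> *s x)"

text \<open>Only meaningful when there is exactly one normal eigenvalue, as is the case for a unitarily
  reducible 3-by-3 matrix whose numerical range is an ellipse.\<close>

definition the_normal_eigenvalue :: "complex^'n^'n \<Rightarrow> complex" where
  "the_normal_eigenvalue A = (THE \<alpha>. normal_eigenvalue A \<alpha>)"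

text \<open>The two proper blocks of a 3-by-3 matrix have sizes 1 and 2, in either order.\<close>

definition block_diagonal3 :: "complex^3^3 \<Rightarrow> bool" where
  "block_diagonal3 B \<longleftrightarrow>
    (B $ 1 $ 2 = 0 \<and> B $ 1 $ 3 = 0 \<and> B $ 2 $ 1 = 0 \<and> B $ 3 $ 1 = 0) \<or>
    (B $ 1 $ 3 = 0 \<and> B $ 2 $ 3 = 0 \<and> B $ 3 $ 1 = 0 \<and> B $ 3 $ 2 = 0)"

definition unitarily_reducible :: "complex^3^3 \<Rightarrow> bool" where
  "unitarily_reducible A \<longleftrightarrow> (\<exists>B. unitarily_similar A B \<and> block_diagonal3 B)"

definition is_point :: "complex set \<Rightarrow> bool" where
  "is_point S \<longleftrightarrow> (\<exists>p. S = {p})"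

definition is_segment :: "complex set \<Rightarrow> bool" where
  "is_segment S \<longleftrightarrow> (\<exists>a b. a \<noteq> b \<and> S = closed_segment a b)"

text \<open>Closed elliptical region with foci \<open>f\<close>, \<open>g\<close> and major axis \<open>d\<close>; \<open>d\<close> exceeding the focal
  distance makes the interior non-empty, and \<open>f = g\<close> gives the circular disks.\<close>

definition is_ellipse :: "complex set \<Rightarrow> bool" where
  "is_ellipse S \<longleftrightarrow> (\<exists>f g d. dist f g < d \<and> S = {z. dist z f + dist z g \<le> d})"

definition flat_boundary_portion :: "complex set \<Rightarrow> complex set \<Rightarrow> bool" where
  "flat_boundary_portion S X \<longleftrightarrow> is_segment S \<and> S \<subseteq> frontier X \<and>
    (\<forall>T. is_segment T \<and> S \<subseteq> T \<and> T \<subseteq> frontier X \<longrightarrow> T = S)"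

definition E3 :: "(complex^3^3) set" where
  "E3 = {A. \<not> unitarily_reducible A \<and> is_ellipse (numerical_range A)}"

definition F3 :: "(complex^3^3) set" where
  "F3 = {A. \<not> unitarily_reducible A \<and> (\<exists>S. flat_boundary_portion S (numerical_range A))}"

end

theory Submission
  imports Defs
begin

text \<open>Write \<open>q(x) = x\<^sup>* A x\<close>, so that \<open>W(A)\<close> is the image of the unit sphere under \<open>q\<close>. Two reformulations
  turn the geometry into linear algebra. A 3-by-3 matrix is unitarily reducible exactly when it has
  a normal eigenvector (\<open>unitarily_reducible_iff\<close>). Since \<open>W(A)\<close> is convex
  (\<open>Toeplitz_Hausdorff\<close>), it has a flat boundary portion exactly when some non-zero real-linear
  functional \<open>z \<mapsto> Re (a z)\<close> attains its maximum over \<open>W(A)\<close> at two distinct points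
  (\<open>flat_boundary_portion_iff\<close>); and a unit vector at which \<open>Re (a q)\<close> is maximal is an eigenvector of
  the hermitian matrix \<open>a A + (a A)\<^sup>*\<close> (\<open>maximiser_eigenvector\<close>).

  \<^bold>\<open>From the closures to reducible matrices.\<close> Numerical ranges depend continuously on the matrix, and a
  limit of ellipses is an ellipse, a segment or a point (\<open>closure_E3_numerical_range\<close>). If \<open>W(A)\<close> lies
  on a line, then \<open>A\<close> is, up to an affine map, a skew-hermitian matrix, and such a matrix has normal
  eigenvectors. Suppose that \<open>W(A)\<close> is an ellipse. For a matrix with a flat portion the top eigenspace
  of some \<open>a A + (a A)\<^sup>*\<close> is at least two-dimensional, and by compactness this survives in the limit
  (\<open>closure_F3_double_support\<close>). All unit vectors of that eigenspace have values under \<open>q\<close> on one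
  supporting line of a strictly convex set, hence the same value \<open>\<alpha>\<close>, a boundary point. So \<open>A\<close>
  compresses to \<open>\<alpha>\<close> on a plane, and the plane contains a vector on which the remaining one-dimensional
  component of \<open>A\<close> vanishes; this vector is a normal eigenvector for \<open>\<alpha>\<close>
  (\<open>double_support_normal_eigenvalue\<close>).

  \<^bold>\<open>From reducible matrices to the closures.\<close> The three kinds of matrices share one normal form. In each
  case there are orthonormal \<open>u\<close>, \<open>v\<close> such that \<open>u\<close> is a normal eigenvector for \<open>\<alpha>\<close>, \<open>q(v) = \<alpha>\<close>, and
  \<open>\<alpha>\<close> minimises some \<open>Re (a z)\<close> over \<open>W(A)\<close>. If \<open>W(A)\<close> lies on a line, \<open>\<alpha>\<close> is the middle one of the
  three collinear eigenvalues, and \<open>v\<close> mixes the eigenvectors of the two outer ones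
  (\<open>collinear_range_eigenvectors\<close>). If \<open>W(A)\<close> is an ellipse with \<open>\<alpha>\<close> on its boundary, \<open>v\<close> exists
  because otherwise \<open>W(A)\<close> would lie in a cone with apex \<open>\<alpha>\<close> and opening angle less than \<open>\<pi>\<close>, while
  an ellipse has no corners (\<open>ellipse_not_in_cone\<close>). Such \<open>u\<close>, \<open>v\<close> bring \<open>A\<close>, after an affine map and a
  unitary similarity, to the matrix with rows \<open>(0, 0, 0)\<close>, \<open>(0, 0, k)\<close>, \<open>(0, - cnj k, t)\<close> where
  \<open>Re t \<ge> 0\<close> (\<open>in_both_closures\<close>). This matrix has irreducible perturbations of both kinds, where \<open>k\<close> is
  made non-zero first: with a small number in the lower left corner the numerical range is an affine
  image of a ball, hence an ellipse (\<open>ellipse_family_in_E3\<close>), and with a small skew-hermitian perturbation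
  of the first row and column and \<open>Re t > 0\<close> it has a flat portion on the imaginary axis
  (\<open>flat_family_in_F3\<close>).\<close>

section \<open>The complex scalar product and the quadratic form of a matrix\<close>

lemma cscalar_prod_add_left: "cscalar_prod (x + y) z = cscalar_prod x z + cscalar_prod y z"
  by (simp add: cscalar_prod_def sum.distrib distrib_right)

lemma cscalar_prod_add_right: "cscalar_prod x (y + z) = cscalar_prod x y + cscalar_prod x z"
  by (simp add: cscalar_prod_def sum.distrib distrib_left)

lemma cscalar_prod_diff_left: "cscalar_prod (x - y) z = cscalar_prod x z - cscalar_prod y z"
  by (simp add: cscalar_prod_def sum_subtractf left_diff_distrib)

lemma cscalar_prod_diff_right: "cscalar_prod x (y - z) = cscalar_prod x y - cscalar_prod x z"
  by (simp add: cscalar_prod_def sum_subtractf right_diff_distrib)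

lemma cscalar_prod_uminus: "cscalar_prod x (- y) = - cscalar_prod x y"
  by (simp add: cscalar_prod_def sum_negf)

lemma cscalar_prod_scale_left: "cscalar_prod (c *s x) y = cnj c * cscalar_prod x y"
  by (simp add: cscalar_prod_def sum_distrib_left mult.assoc)

lemma cscalar_prod_scale_right: "cscalar_prod x (c *s y) = c * cscalar_prod x y"
  by (simp add: cscalar_prod_def sum_distrib_left algebra_simps)

lemma cscalar_prod_zero [simp]: "cscalar_prod 0 x = 0" "cscalar_prod x 0 = 0"
  by (simp_all add: cscalar_prod_def)

lemmas cscalar_prod_simps =
  cscalar_prod_add_left cscalar_prod_add_right cscalar_prod_diff_left cscalar_prod_diff_right
  cscalar_prod_scale_left cscalar_prod_scale_right

lemma cnj_cscalar_prod: "cnj (cscalar_prod x y) = cscalar_prod y x"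
  by (simp add: cscalar_prod_def mult.commute)

lemma Re_cscalar_prod: "Re (cscalar_prod x y) = x \<bullet> y"
  by (simp add: cscalar_prod_def inner_vec_def inner_complex_def)

lemma cscalar_prod_self: "cscalar_prod x x = complex_of_real ((norm x)\<^sup>2)"
proof (rule complex_eqI)
  show "Re (cscalar_prod x x) = Re (complex_of_real ((norm x)\<^sup>2))"
    by (simp add: Re_cscalar_prod power2_norm_eq_inner)
  have "cnj (cscalar_prod x x) = cscalar_prod x x" by (rule cnj_cscalar_prod)
  then show "Im (cscalar_prod x x) = Im (complex_of_real ((norm x)\<^sup>2))"
    by (metis Im_complex_of_real Reals_cnj_iff complex_is_Real_iff)
qed

lemma cscalar_prod_self_eq_1: "cscalar_prod x x = 1 \<longleftrightarrow> norm x = 1"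
proof -
  have "cscalar_prod x x = 1 \<longleftrightarrow> (norm x)\<^sup>2 = 1"
    by (metis cscalar_prod_self of_real_eq_1_iff)
  then show ?thesis by (simp add: power2_eq_1_iff) (smt (verit) norm_ge_zero)
qed

lemma cscalar_prod_adjoint_left:
  "cscalar_prod (herm_adjoint A *v x) y = cscalar_prod x (A *v y)"
proof -
  have "cscalar_prod (herm_adjoint A *v x) y
      = (\<Sum>i\<in>UNIV. \<Sum>j\<in>UNIV. A $ j $ i * cnj (x $ j) * y $ i)"
    by (simp add: cscalar_prod_def herm_adjoint_def matrix_vector_mult_def sum_distrib_right)
  also have "\<dots> = (\<Sum>j\<in>UNIV. \<Sum>i\<in>UNIV. A $ j $ i * cnj (x $ j) * y $ i)"
    by (rule sum.swap)
  also have "\<dots> = cscalar_prod x (A *v y)"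
    by (simp add: cscalar_prod_def matrix_vector_mult_def sum_distrib_left algebra_simps)
  finally show ?thesis .
qed

lemma herm_adjoint_invol [simp]: "herm_adjoint (herm_adjoint A) = A"
  by (simp add: herm_adjoint_def vec_eq_iff)

lemma cscalar_prod_adjoint_right:
  "cscalar_prod x (herm_adjoint A *v y) = cscalar_prod (A *v x) y"
  by (metis cscalar_prod_adjoint_left herm_adjoint_invol)

lemma mat_vector_mult: "mat c *v x = c *s (x :: complex^'n)"
  by (simp add: vec_eq_iff matrix_vector_mult_def mat_def if_distrib if_distribR sum.delta' cong: if_cong)

lemma matrix_vector_mult_scale: "A *v (c *s x) = c *s (A *v (x :: complex^'n))"
  by (simp add: vec_eq_iff matrix_vector_mult_def sum_distrib_left algebra_simps)

lemma norm_scale: "norm (c *s (x :: complex^'n)) = norm c * norm x"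
  by (simp add: norm_vec_def L2_set_right_distrib norm_mult)

definition qform :: "complex^'n^'n \<Rightarrow> complex^'n \<Rightarrow> complex" where
  "qform A x = cscalar_prod x (A *v x)"

lemma numerical_range_eq: "numerical_range A = qform A ` sphere 0 1"
  by (auto simp: numerical_range_def qform_def cscalar_prod_self_eq_1 image_def)

lemma qform_scale: "qform A (c *s x) = of_real ((norm c)\<^sup>2) * qform A x"
proof -
  have "qform A (c *s x) = (c * cnj c) * qform A x"
    by (simp add: qform_def matrix_vector_mult_scale cscalar_prod_simps mult.assoc)
  then show ?thesis by (simp add: complex_norm_square[symmetric])
qed

text \<open>Multiplication by \<open>cnj (sgn z)\<close> rotates \<open>z\<close> onto the non-negative real axis; phases are
  chosen below in this way.\<close>

lemma cnj_sgn_mult: "cnj (sgn z) * z = of_real (norm z)"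
  by (cases "z = 0") (simp_all add: sgn_eq field_simps complex_norm_square[symmetric] power2_eq_square)

lemma tendsto_cscalar_prod [tendsto_intros]:
  assumes "(f \<longlongrightarrow> x) F" "(g \<longlongrightarrow> y) F"
  shows "((\<lambda>n. cscalar_prod (f n) (g n)) \<longlongrightarrow> cscalar_prod x y) F"
  unfolding cscalar_prod_def by (intro tendsto_intros assms)

lemma tendsto_matrix_vector_mult [tendsto_intros]:
  fixes f :: "_ \<Rightarrow> complex^'n^'m"
  assumes "(f \<longlongrightarrow> A) F" "(g \<longlongrightarrow> y) F"
  shows "((\<lambda>n. f n *v g n) \<longlongrightarrow> A *v y) F"
  unfolding matrix_vector_mult_def by (intro vec_tendstoI) (simp, intro tendsto_intros assms)

lemma tendsto_matrix_mult [tendsto_intros]: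
  fixes f :: "_ \<Rightarrow> complex^'n^'m"
  assumes "(f \<longlongrightarrow> A) F" "(g \<longlongrightarrow> y) F"
  shows "((\<lambda>n. f n ** g n) \<longlongrightarrow> A ** y) F"
  unfolding matrix_matrix_mult_def by (intro vec_tendstoI) (simp, intro tendsto_intros assms)

lemma tendsto_qform [tendsto_intros]:
  assumes "(f \<longlongrightarrow> A) F" "(g \<longlongrightarrow> y) F"
  shows "((\<lambda>n. qform (f n) (g n)) \<longlongrightarrow> qform A y) F"
  unfolding qform_def by (intro tendsto_intros assms)

lemma tendsto_scale [tendsto_intros]:
  fixes g :: "_ \<Rightarrow> complex^'n"
  assumes "(f \<longlongrightarrow> c) F" "(g \<longlongrightarrow> y) F"
  shows "((\<lambda>n. f n *s g n) \<longlongrightarrow> c *s y) F"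
  by (intro vec_tendstoI) (simp, intro tendsto_intros assms)

lemma tendsto_herm_adjoint [tendsto_intros]:
  assumes "(f \<longlongrightarrow> A) F" 
  shows "((\<lambda>n. herm_adjoint (f n)) \<longlongrightarrow> herm_adjoint A) F"
  unfolding herm_adjoint_def by (intro vec_tendstoI) (simp, intro tendsto_intros assms)

section \<open>Maximisers of the real part of a rotated quadratic form\<close>

text \<open>First variation: along the ray \<open>x + t w\<close> with \<open>w = R x - c x\<close> the non-negative function
  \<open>c |y|\<^sup>2 - \<langle>y, R y\<rangle>\<close> equals \<open>t\<^sup>2 g - 2 t |w|\<^sup>2\<close> for a constant \<open>g\<close>, and this is non-negative for all
  small \<open>t > 0\<close> only if \<open>w = 0\<close>.\<close>

lemma selfadjoint_maximiser_eigenvector: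
  fixes R :: "'a::real_inner \<Rightarrow> 'a"
  assumes R: "linear R" and sym: "\<And>y z. y \<bullet> R z = R y \<bullet> z"
    and le: "\<And>y. y \<bullet> R y \<le> c * (y \<bullet> y)" and eq: "x \<bullet> R x = c * (x \<bullet> x)"
  shows "R x = c *\<^sub>R x"
proof -
  interpret linear R by fact
  define w where "w = R x - c *\<^sub>R x"
  define g where "g = c * (w \<bullet> w) - w \<bullet> R w"
  have g: "g \<ge> 0" using le[of w] by (simp add: g_def)
  have main: "2 * (t * (w \<bullet> w)) \<le> t\<^sup>2 * g" for t :: real
  proof -
    have xw: "x \<bullet> R w = R x \<bullet> w" by (rule sym)
    have wx: "w \<bullet> R x = R x \<bullet> w" "w \<bullet> x = x \<bullet> w" by (rule inner_commute)+
    have "(x + t *\<^sub>R w) \<bullet> R (x + t *\<^sub>R w)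
        = x \<bullet> R x + 2 * t * (R x \<bullet> w) + t\<^sup>2 * (w \<bullet> R w)"
      by (simp add: add scale inner_add_left inner_add_right power2_eq_square xw wx
          distrib_left distrib_right del: inner_diff_left inner_diff_right)
    moreover have "(x + t *\<^sub>R w) \<bullet> (x + t *\<^sub>R w) = x \<bullet> x + 2 * t * (x \<bullet> w) + t\<^sup>2 * (w \<bullet> w)"
      by (simp add: inner_add_left inner_add_right power2_eq_square wx distrib_left distrib_right)
    moreover have "w \<bullet> w = R x \<bullet> w - c * (x \<bullet> w)"
      by (simp add: w_def inner_diff_left)
    moreover have "t * (w \<bullet> w) = t * (R x \<bullet> w) - t * (c * (x \<bullet> w))"
      using calculation(3) by (metis right_diff_distrib)
    ultimately show ?thesis
      using le[of "x + t *\<^sub>R w"] eq by (simp add: g_def distrib_left right_diff_distrib mult.left_commute mult.commute)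
  qed
  have "w \<bullet> w \<le> 0"
  proof (cases "g = 0")
    case True
    then show ?thesis using main[of 1] by simp
  next
    case False
    \<comment> \<open>the minimiser in \<open>t\<close> of the quadratic polynomial\<close>
    then have "2 * ((w \<bullet> w / g) * (w \<bullet> w)) \<le> (w \<bullet> w / g)\<^sup>2 * g" by (intro main)
    also have "\<dots> = (w \<bullet> w / g) * (w \<bullet> w)" using False by (simp add: power2_eq_square)
    finally have "(w \<bullet> w)\<^sup>2 / g \<le> 0" by (simp add: power2_eq_square)
    then have "(w \<bullet> w)\<^sup>2 \<le> 0" using g False by (simp add: divide_le_0_iff)
    then show ?thesis by simp
  qed
  then have "w = 0" by (metis inner_eq_zero_iff inner_ge_zero order_antisym)
  then show ?thesis by (simp add: w_def)
qed

text \<open>The operator \<open>a A + (a A)\<^sup>*\<close>, twice the hermitian part of \<open>a A\<close>. It governs the extent of the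
  numerical range in the direction \<open>cnj a\<close>.\<close>

definition herm_part :: "complex \<Rightarrow> complex^'n^'n \<Rightarrow> complex^'n \<Rightarrow> complex^'n" where
  "herm_part a A x = a *s (A *v x) + cnj a *s (herm_adjoint A *v x)"

lemma herm_part_linear: "linear (herm_part a A)"
  unfolding herm_part_def
  by (rule linearI) (simp_all add: matrix_vector_right_distrib vec_eq_iff
      matrix_vector_mult_def sum_distrib_left sum.distrib scaleR_conv_of_real[where 'a=complex] algebra_simps)

lemma herm_part_scale: "herm_part a A (c *s x) = c *s herm_part a A x"
  unfolding herm_part_def
  by (simp add: matrix_vector_mult_scale vector_add_ldistrib mult.commute)

lemma herm_part_diff: "herm_part a A (x - y) = herm_part a A x - herm_part a A y"
  by (rule linear_diff[OF herm_part_linear])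

lemma inner_herm_part: "x \<bullet> herm_part a A x = 2 * Re (a * qform A x)"
proof -
  have "cscalar_prod x (herm_part a A x) = a * qform A x + cnj (a * qform A x)"
    unfolding herm_part_def qform_def
    by (simp add: cscalar_prod_simps cscalar_prod_adjoint_right cnj_cscalar_prod)
  then have "Re (cscalar_prod x (herm_part a A x)) = 2 * Re (a * qform A x)" by simp
  then show ?thesis by (simp only: Re_cscalar_prod)
qed

lemma herm_part_selfadjoint: "x \<bullet> herm_part a A y = herm_part a A x \<bullet> y"
proof -
  have "cscalar_prod x (herm_part a A y) = cscalar_prod (herm_part a A x) y"
    unfolding herm_part_def
    by (simp add: cscalar_prod_simps cscalar_prod_adjoint_right cscalar_prod_adjoint_left)
  then show ?thesis by (metis Re_cscalar_prod)
qed

lemma qform_le_scaled: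
  assumes "\<And>y. norm y = 1 \<Longrightarrow> Re (a * qform A y) \<le> m"
  shows "Re (a * qform A y) \<le> m * (norm y)\<^sup>2"
proof (cases "y = 0")
  case True then show ?thesis by (simp add: qform_def)
next
  case False
  define z where "z = complex_of_real (inverse (norm y)) *s y"
  have "norm z = 1" using False by (simp add: z_def norm_scale norm_of_real del: of_real_inverse)
  moreover have y: "y = complex_of_real (norm y) *s z" using False by (simp add: z_def)
  moreover have "qform A y = of_real ((norm y)\<^sup>2) * qform A z"
    by (subst y) (simp add: qform_scale)
  ultimately show ?thesis using assms[of z]
    by (simp add: mult.left_commute[of a] mult_left_mono mult.commute[of m] del: of_real_power)
qed

lemma maximiser_eigenvector:
  assumes "\<And>y. norm y = 1 \<Longrightarrow> Re (a * qform A y) \<le> m"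
    and "norm x = 1" "Re (a * qform A x) = m"
  shows "herm_part a A x = of_real (2 * m) *s x"
proof -
  have "herm_part a A x = (2 * m) *\<^sub>R x"
  proof (rule selfadjoint_maximiser_eigenvector[OF herm_part_linear herm_part_selfadjoint])
    show "y \<bullet> herm_part a A y \<le> 2 * m * (y \<bullet> y)" for y
      using qform_le_scaled[of a A m y] assms(1) by (simp add: inner_herm_part power2_norm_eq_inner)
    show "x \<bullet> herm_part a A x = 2 * m * (x \<bullet> x)"
      using assms by (simp add: inner_herm_part flip: power2_norm_eq_inner)
  qed
  then show ?thesis by (simp add: vec_eq_iff scaleR_conv_of_real[where 'a=complex])
qed

lemma compact_numerical_range: "compact (numerical_range A)"
proof -
  have "continuous_on (sphere 0 1) (qform A)"
    unfolding continuous_on_def by (auto intro!: tendsto_intros)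
  then show ?thesis unfolding numerical_range_eq by (intro compact_continuous_image) auto
qed

lemma numerical_rangeI: "norm x = 1 \<Longrightarrow> qform A x \<in> numerical_range A"
  by (auto simp: numerical_range_eq)

lemma qform_add:
  "qform A (x + y) = qform A x + qform A y + (cscalar_prod x (A *v y) + cscalar_prod y (A *v x))"
  by (simp add: qform_def matrix_vector_right_distrib cscalar_prod_simps)

section \<open>Convexity of the numerical range\<close>

lemma affine_vector_mult:
  "(mat c ** A + mat b) *v x = c *s (A *v x) + b *s (x :: complex^'n)"
  by (simp add: matrix_vector_mult_add_rdistrib mat_vector_mult flip: matrix_vector_mul_assoc)

lemma qform_affine:
  "qform (mat c ** A + mat b) x = c * qform A x + b * of_real ((norm x)\<^sup>2)"
  by (simp add: qform_def affine_vector_mult cscalar_prod_simps cscalar_prod_self)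

lemma numerical_range_affine:
  "numerical_range (mat c ** A + mat b) = (\<lambda>z. c * z + b) ` numerical_range A"
  by (force simp: numerical_range_eq qform_affine image_iff)

lemma qform_normalise:
  assumes "z \<noteq> 0"
  shows "\<exists>w. norm w = 1 \<and> qform A w = qform A z / of_real ((norm z)\<^sup>2)"
proof (intro exI conjI)
  define w where "w = complex_of_real (1 / norm z) *s z"
  show "norm w = 1"
    using assms by (simp add: w_def norm_scale norm_divide)
  show "qform A w = qform A z / of_real ((norm z)\<^sup>2)"
    unfolding w_def by (simp add: qform_scale norm_divide power_divide)
qed

text \<open>Toeplitz' argument: after a rotation of \<open>x\<close> by a suitable phase the form is real on the real span
  of \<open>x\<close> and \<open>y\<close>, so on a path from \<open>x\<close> to \<open>y\<close> its normalised value runs continuously through all of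
  \<open>[0, 1]\<close>.\<close>

lemma unit_interval_in_numerical_range:
  fixes A :: "complex^'n^'n"
  assumes x: "norm x = 1" "qform A x = 0" and y: "norm y = 1" "qform A y = 1"
    and t: "0 \<le> t" "t \<le> 1"
  shows "complex_of_real t \<in> numerical_range A"
proof -
  \<comment> \<open>the mixed terms of the form have imaginary part \<open>Im (\<gamma> d)\<close>\<close>
  define d where "d = cscalar_prod y (A *v x) - cnj (cscalar_prod x (A *v y))"
  define \<gamma> where "\<gamma> = (if d = 0 then 1 else cnj (sgn d))"
  have \<gamma>: "norm \<gamma> = 1" by (simp add: \<gamma>_def norm_sgn)
  define k where "k = cnj \<gamma> * cscalar_prod x (A *v y) + \<gamma> * cscalar_prod y (A *v x)"
  have "Im (\<gamma> * d) = 0"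
    by (simp add: \<gamma>_def cnj_sgn_mult del: times_complex.simps)
  then have k: "Im k = 0" by (simp add: k_def d_def algebra_simps)
  define z where "z s = complex_of_real (1 - s) *s (\<gamma> *s x) + complex_of_real s *s y" for s
  have qz: "qform A (z s) = of_real (s\<^sup>2 + s * (1 - s) * Re k)" for s
  proof -
    have "qform A (z s) = of_real (s\<^sup>2) + of_real (s * (1 - s)) * k"
      unfolding z_def qform_add qform_scale using x y
      by (simp add: matrix_vector_mult_scale cscalar_prod_simps k_def algebra_simps)
    moreover have "k = of_real (Re k)" using k by (simp add: complex_eq_iff)
    ultimately show ?thesis by (metis of_real_add of_real_mult)
  qed
  have nz: "z s \<noteq> 0" if "0 \<le> s" "s \<le> 1" for s
  proof
    assume "z s = 0"
    then have e: "complex_of_real (1 - s) *s (\<gamma> *s x) = - (complex_of_real s *s y)"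
      by (simp add: z_def add_eq_0_iff2)
    then have "norm (complex_of_real (1 - s) *s (\<gamma> *s x)) = norm (complex_of_real s *s y)"
      by simp
    then have "1 - s = s" using that x y \<gamma> by (simp add: norm_scale norm_mult del: of_real_diff)
    then have "s = 1/2" by simp
    then have "qform A (z s) = 0" using \<open>z s = 0\<close> by (simp add: qform_def)
    moreover have "qform A (complex_of_real (1 - s) *s (\<gamma> *s x)) = qform A ((- complex_of_real s) *s y)"
      using e by (metis vector_sneg_minus1 vector_smult_assoc mult_minus1)
    ultimately have "of_real ((norm (complex_of_real (1 - s)))\<^sup>2) * (of_real ((norm \<gamma>)\<^sup>2) * qform A x)
        = of_real ((norm (- complex_of_real s))\<^sup>2) * qform A y"
      unfolding qform_scale by simp
    then show False using x y \<open>s = 1/2\<close> by simp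
  qed
  define g where "g s = Re (qform A (z s)) / (norm (z s))\<^sup>2" for s
  have z_lim: "(z \<longlongrightarrow> z s) (at s within {0..1})" for s
    unfolding z_def by (intro tendsto_intros)
  have cont: "continuous_on {0..1} g"
    unfolding continuous_on_def g_def by (auto intro!: tendsto_intros z_lim dest: nz)
  have "z 0 = \<gamma> *s x" "z 1 = y" by (simp_all add: z_def)
  then have "g 0 = 0" "g 1 = 1" using x y by (simp_all add: g_def qform_scale)
  then obtain s where s: "0 \<le> s" "s \<le> 1" "g s = t"
    using IVT'[of g 0 t 1] t cont by auto
  obtain w where "norm w = 1" "qform A w = qform A (z s) / of_real ((norm (z s))\<^sup>2)"
    using qform_normalise nz s by blast
  moreover have "qform A (z s) / of_real ((norm (z s))\<^sup>2) = of_real t"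
    using s(3) unfolding g_def qz Re_complex_of_real of_real_divide[symmetric] by simp
  ultimately show ?thesis by (metis numerical_rangeI)
qed

text \<open>An affine map sends any two distinct points of the numerical range to 0 and 1.\<close>

theorem Toeplitz_Hausdorff: "convex (numerical_range (A :: complex^'n^'n))"
  unfolding convex_contains_segment
proof (intro ballI subsetI)
  fix p r z
  assume p: "p \<in> numerical_range A" and r: "r \<in> numerical_range A" and z: "z \<in> closed_segment p r"
  show "z \<in> numerical_range A"
  proof (cases "p = r")
    case True then show ?thesis using p z by simp
  next
    case False
    obtain x y where x: "norm x = 1" "p = qform A x" and y: "norm y = 1" "r = qform A y"
      using p r by (auto simp: numerical_range_eq)
    define B where "B = mat (1 / (r - p)) ** A + mat (- p / (r - p))"
    obtain t where t: "0 \<le> t" "t \<le> 1" "z = (1 - t) *\<^sub>R p + t *\<^sub>R r"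
      using z by (auto simp: in_segment)
    have "qform B x = 0" "qform B y = 1"
      using x y False by (simp_all add: B_def qform_affine flip: diff_divide_distrib)
    then have "complex_of_real t \<in> numerical_range B"
      using unit_interval_in_numerical_range x y t by blast
    then obtain u where u: "u \<in> numerical_range A" "of_real t = (1 / (r - p)) * u + - p / (r - p)"
      unfolding B_def numerical_range_affine by auto
    have "of_real t * (r - p) = u - p" using u(2) False
      by (simp add: nonzero_divide_eq_eq flip: diff_divide_distrib)
    then have "u = z" using t(3) by (simp add: scaleR_conv_of_real algebra_simps)
    then show ?thesis using u by simp
  qed
qed

section \<open>Maximisers of linear functionals on planar sets\<close>

lemma inner_complex_Re: "Re (a * z) = cnj a \<bullet> z"
  by (simp add: inner_complex_def)

text \<open>From an interior point one can move a little in the direction \<open>cnj a\<close>, which increases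
  \<open>Re (a z)\<close>.\<close>

lemma maximiser_in_frontier:
  assumes "a \<noteq> 0" "\<alpha> \<in> X" "\<And>z. z \<in> X \<Longrightarrow> Re (a * z) \<le> Re (a * \<alpha>)"
  shows "\<alpha> \<in> frontier X"
proof (rule ccontr)
  assume "\<alpha> \<notin> frontier X"
  then have "\<alpha> \<in> interior X" using assms(2) closure_subset by (auto simp: frontier_def)
  then obtain e where e: "e > 0" "cball \<alpha> e \<subseteq> X" by (meson mem_interior_cball)
  define h where "h = of_real e * cnj (sgn a)"
  have "dist \<alpha> (\<alpha> + h) \<le> e" using e by (simp add: h_def norm_mult norm_sgn dist_norm)
  then have "\<alpha> + h \<in> X" using e by auto
  then have "Re (a * (\<alpha> + h)) \<le> Re (a * \<alpha>)" by (rule assms(3))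
  moreover have "a * cnj (sgn a) = of_real (norm a)"
    by (metis cnj_sgn_mult complex_cnj_cnj complex_cnj_complex_of_real complex_cnj_mult mult.commute)
  then have "a * h = of_real (e * norm a)" by (simp add: h_def mult.left_commute)
  then have "Re (a * (\<alpha> + h)) = Re (a * \<alpha>) + e * norm a"
    by (simp only: distrib_left plus_complex.sel Re_complex_of_real)
  ultimately have "e * norm a \<le> 0" by simp
  then show False using e assms(1) by (simp add: mult_le_0_iff)
qed

text \<open>A convex set with empty interior is contained in a line, which then supports it at each of its
  points; this case is separate because the relative boundary is smaller than the frontier.\<close>

lemma frontier_supporting_line:
  assumes "convex X" "x \<in> X" "x \<in> frontier X"
  shows "\<exists>a. a \<noteq> 0 \<and> (\<forall>z\<in>X. Re (a * z) \<le> Re (a * x))"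
proof (cases "interior X = {}")
  case True
  then obtain a b where "a \<noteq> 0" "X \<subseteq> {z. a \<bullet> z = b}"
    using empty_interior_subset_hyperplane assms(1) by blast
  then have "\<forall>z\<in>X. a \<bullet> z = a \<bullet> x" using assms(2) by blast
  then show ?thesis using \<open>a \<noteq> 0\<close>
    by (intro exI[of _ "cnj a"]) (simp add: inner_complex_Re del: times_complex.simps)
next
  case False
  then have "x \<notin> rel_interior X" using assms(3) by (simp add: frontier_def rel_interior_nonempty_interior)
  then obtain a where "a \<noteq> 0" "\<And>z. z \<in> X \<Longrightarrow> a \<bullet> x \<le> a \<bullet> z"
    using supporting_hyperplane_rel_boundary[OF assms(1,2)] by metis
  then show ?thesis by (intro exI[of _ "- cnj a"]) (simp add: inner_complex_Re del: times_complex.simps)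
qed

section \<open>Ellipses\<close>

text \<open>Strict convexity of the sum of the focal distances. Equality in the two triangle inequalities makes
  \<open>z2 - z1\<close> parallel to \<open>z1 - f\<close> and to \<open>z1 - g\<close>, and comparing the factors shows that the foci would
  be at distance at least \<open>d\<close>.\<close>

lemma ellipse_midpoint_strict:
  fixes f g z1 z2 :: "'a::real_inner"
  assumes "dist f g < d" and le: "dist z1 f + dist z1 g \<le> d" "dist z2 f + dist z2 g \<le> d" and "z1 \<noteq> z2"
  shows "dist (midpoint z1 z2) f + dist (midpoint z1 z2) g < d"
proof (rule ccontr)
  assume *: "\<not> ?thesis"
  define r1 r2 s1 s2 where "r1 = norm (z1 - f)" "r2 = norm (z2 - f)" "s1 = norm (z1 - g)" "s2 = norm (z2 - g)"
  note defs = this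
  have mid: "dist (midpoint z1 z2) h = norm ((z1 - h) + (z2 - h)) / 2" for h
  proof -
    have "midpoint z1 z2 - h = (1/2) *\<^sub>R ((z1 - h) + (z2 - h))"
      by (simp add: midpoint_def algebra_simps flip: scaleR_2)
    then show ?thesis by (simp add: dist_norm)
  qed
  have "norm ((z1 - f) + (z2 - f)) \<le> r1 + r2" "norm ((z1 - g) + (z2 - g)) \<le> s1 + s2"
    unfolding defs by (rule norm_triangle_ineq)+
  moreover have "r1 + s1 \<le> d" "r2 + s2 \<le> d" using le by (simp_all add: defs dist_norm)
  ultimately have eq: "norm ((z1 - f) + (z2 - f)) = r1 + r2" "norm ((z1 - g) + (z2 - g)) = s1 + s2"
      "r1 + s1 = d" "r2 + s2 = d"
    using * unfolding mid by linarith+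
  have "r1 *\<^sub>R (z2 - f) = r2 *\<^sub>R (z1 - f)" "s1 *\<^sub>R (z2 - g) = s2 *\<^sub>R (z1 - g)"
    using eq(1,2) unfolding defs norm_triangle_eq by auto
  then have "r1 *\<^sub>R (z2 - z1) = (r2 - r1) *\<^sub>R (z1 - f)" "s1 *\<^sub>R (z2 - z1) = (s2 - s1) *\<^sub>R (z1 - g)"
    by (simp_all add: algebra_simps)
  moreover have "s2 - s1 = - (r2 - r1)" using eq by simp
  ultimately have "(r1 + s1) *\<^sub>R (z2 - z1) = (r2 - r1) *\<^sub>R (g - f)"
    by (simp add: scaleR_left_distrib) (simp add: algebra_simps)
  then have "norm (d *\<^sub>R (z2 - z1)) = norm ((r2 - r1) *\<^sub>R (g - f))" by (simp add: eq)
  then have "\<bar>d\<bar> * norm (z2 - z1) = \<bar>r2 - r1\<bar> * norm (g - f)" by simp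
  also have "\<bar>r2 - r1\<bar> \<le> norm ((z2 - f) - (z1 - f))"
    unfolding defs by (rule norm_triangle_ineq3)
  then have "\<bar>r2 - r1\<bar> * norm (g - f) \<le> norm (z2 - z1) * norm (g - f)"
    by (intro mult_right_mono) simp_all
  finally have "\<bar>d\<bar> \<le> norm (g - f)" using \<open>z1 \<noteq> z2\<close> by (simp add: mult.commute)
  then show False using assms(1) by (simp add: dist_norm norm_minus_commute)
qed

lemma ellipse_frontier_eq:
  fixes f g \<alpha> :: "'a::real_normed_vector"
  assumes "\<alpha> \<in> frontier {z. dist z f + dist z g \<le> d}"
  shows "dist \<alpha> f + dist \<alpha> g = d"
proof -
  have "closed {z. dist z f + dist z g \<le> d}" by (intro closed_Collect_le continuous_intros)
  then have "dist \<alpha> f + dist \<alpha> g \<le> d" using assms frontier_subset_closed by blast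
  moreover have "open {z. dist z f + dist z g < d}" by (intro open_Collect_less continuous_intros)
  then have "{z. dist z f + dist z g < d} \<subseteq> interior {z. dist z f + dist z g \<le> d}"
    by (intro interior_maximal) auto
  then have "\<not> dist \<alpha> f + dist \<alpha> g < d" using assms by (auto simp: frontier_def)
  ultimately show ?thesis by simp
qed

text \<open>The midpoint of two distinct maximisers would be a maximiser in the interior.\<close>

lemma ellipse_maximiser_unique:
  assumes E: "is_ellipse X" and "a \<noteq> 0" and z: "z1 \<in> X" "z2 \<in> X" "Re (a * z1) = m" "Re (a * z2) = m"
    and max: "\<And>z. z \<in> X \<Longrightarrow> Re (a * z) \<le> m"
  shows "z1 = z2"
proof (rule ccontr)
  assume "z1 \<noteq> z2"
  obtain f g d where d: "dist f g < d" and X: "X = {z. dist z f + dist z g \<le> d}"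
    using E by (auto simp: is_ellipse_def)
  have lt: "dist (midpoint z1 z2) f + dist (midpoint z1 z2) g < d"
    using ellipse_midpoint_strict[OF d _ _ \<open>z1 \<noteq> z2\<close>] z X by simp
  have "Re (a * midpoint z1 z2) = m"
    using z by (simp add: midpoint_def scaleR_conv_of_real algebra_simps)
  then have "midpoint z1 z2 \<in> frontier X"
    using max lt X \<open>a \<noteq> 0\<close> by (intro maximiser_in_frontier) auto
  then show False using ellipse_frontier_eq lt unfolding X by fastforce
qed

text \<open>The second-order Taylor bound of the norm at \<open>x\<close>, which follows from
  \<open>2 |x| |x + h| \<le> |x|\<^sup>2 + |x + h|\<^sup>2\<close>.\<close>

lemma norm_add_le_expansion:
  fixes x h :: "'a::real_inner"
  assumes "x \<noteq> 0"
  shows "norm (x + h) \<le> norm x + sgn x \<bullet> h + (norm h)\<^sup>2 / (2 * norm x)"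
proof -
  have "0 \<le> (norm (x + h) - norm x)\<^sup>2" by simp
  then have "2 * norm x * norm (x + h) \<le> (norm (x + h))\<^sup>2 + (norm x)\<^sup>2"
    by (simp add: power2_diff algebra_simps)
  also have "(norm (x + h))\<^sup>2 = (norm x)\<^sup>2 + 2 * (x \<bullet> h) + (norm h)\<^sup>2"
    by (simp add: power2_norm_eq_inner inner_add_left inner_add_right inner_commute)
  finally have "norm (x + h) \<le> (2 * (norm x)\<^sup>2 + 2 * (x \<bullet> h) + (norm h)\<^sup>2) / (2 * norm x)"
    using assms by (simp add: pos_le_divide_eq algebra_simps)
  also have "\<dots> = norm x + sgn x \<bullet> h + (norm h)\<^sup>2 / (2 * norm x)"
    using assms by (simp add: sgn_div_norm power2_eq_square field_simps)
  finally show ?thesis .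
qed

text \<open>An ellipse has a tangent at each boundary point \<open>\<alpha>\<close>. The gradient \<open>n\<close> of the sum of the focal
  distances at \<open>\<alpha>\<close> is not zero, so the ellipse contains the two points at \<open>\<alpha> \<plusminus> \<i> \<tau> n\<close> up to a
  correction of order \<open>\<tau>\<^sup>2\<close>. In a cone the sum of the values of \<open>Re (a z)\<close> at these points (relative to
  \<open>\<alpha>\<close>) would be at least of order \<open>\<tau>\<close>, but it is of order \<open>\<tau>\<^sup>2\<close>.\<close>

lemma ellipse_not_in_cone:
  assumes E: "is_ellipse X" and \<alpha>: "\<alpha> \<in> frontier X" and "m > 0"
    and cone: "\<And>z. z \<in> X \<Longrightarrow> m * norm (z - \<alpha>) \<le> Re (a * (z - \<alpha>))"
  shows False
proof -
  obtain f g d where d: "dist f g < d" and X: "X = {z. dist z f + dist z g \<le> d}"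
    using E by (auto simp: is_ellipse_def)
  have on: "norm (\<alpha> - f) + norm (\<alpha> - g) = d"
    using ellipse_frontier_eq \<alpha> unfolding X dist_norm by blast
  have ne: "\<alpha> - f \<noteq> 0" "\<alpha> - g \<noteq> 0"
    using on d by (auto simp: dist_norm norm_minus_commute)
  define n where "n = sgn (\<alpha> - f) + sgn (\<alpha> - g)"
  have "n \<noteq> 0"
  proof
    assume "n = 0"
    define S where "S = sgn (\<alpha> - g)"
    have "\<alpha> - g = norm (\<alpha> - g) *\<^sub>R S" "norm S = 1"
      using ne by (simp_all add: S_def sgn_div_norm)
    moreover have "sgn (\<alpha> - f) = - S" using \<open>n = 0\<close> by (simp add: n_def S_def add_eq_0_iff2)
    then have "\<alpha> - f = norm (\<alpha> - f) *\<^sub>R - S"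
      using ne by (metis norm_eq_zero sgn_div_norm scaleR_scaleR right_inverse scaleR_one)
    ultimately have "(\<alpha> - g) - (\<alpha> - f) = norm (\<alpha> - g) *\<^sub>R S - norm (\<alpha> - f) *\<^sub>R - S"
      by presburger
    then have "f - g = d *\<^sub>R S" by (simp add: algebra_simps flip: on)
    then have "norm (f - g) = \<bar>d\<bar>" using \<open>norm S = 1\<close> by simp
    then show False using d by (simp add: dist_norm)
  qed
  define C where "C = 1 / (2 * norm (\<alpha> - f)) + 1 / (2 * norm (\<alpha> - g))"
  have "C > 0" using ne by (simp add: C_def add_pos_pos)
  have bound: "norm ((\<alpha> + h) - f) + norm ((\<alpha> + h) - g) \<le> d + n \<bullet> h + C * (norm h)\<^sup>2" for h
    using norm_add_le_expansion[OF ne(1), of h] norm_add_le_expansion[OF ne(2), of h] on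
    by (simp add: n_def C_def inner_add_left distrib_right algebra_simps)
  \<comment> \<open>the first bound keeps the points \<open>\<alpha> + h \<sigma>\<close> below in the ellipse, the second contradicts the cone condition\<close>
  define \<tau> where "\<tau> = min (1 / (2 * C)) (m / (4 * C * (norm a + 1)))"
  have \<tau>: "\<tau> > 0" "2 * C * \<tau> \<le> 1" "4 * C * (norm a + 1) * \<tau> \<le> m"
  proof -
    have p: "4 * C * (norm a + 1) > 0" using \<open>C > 0\<close> by (simp add: add_nonneg_pos)
    show "\<tau> > 0" using \<open>C > 0\<close> \<open>m > 0\<close> p by (simp add: \<tau>_def)
    have "\<tau> \<le> 1 / (2 * C)" "\<tau> \<le> m / (4 * C * (norm a + 1))" by (simp_all add: \<tau>_def)
    then show "2 * C * \<tau> \<le> 1" "4 * C * (norm a + 1) * \<tau> \<le> m"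
      using \<open>C > 0\<close> p by (simp_all add: pos_le_divide_eq mult.commute)
  qed
  define h where "h \<sigma> = of_real (\<sigma> * \<tau>) * (\<i> * n) - of_real (2 * C * \<tau>\<^sup>2) * n" for \<sigma>
  have hX: "\<alpha> + h \<sigma> \<in> X" if "\<sigma>\<^sup>2 = 1" for \<sigma>
  proof -
    have "(norm (h \<sigma>))\<^sup>2 = ((\<sigma> * \<tau>)\<^sup>2 + (2 * C * \<tau>\<^sup>2)\<^sup>2) * (norm n)\<^sup>2"
      unfolding h_def cmod_power2 by (simp add: power2_eq_square algebra_simps)
    also have "(\<sigma> * \<tau>)\<^sup>2 + (2 * C * \<tau>\<^sup>2)\<^sup>2 = \<tau>\<^sup>2 * (1 + (2 * C * \<tau>)\<^sup>2)"
      using that by (simp add: power2_eq_square algebra_simps)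
    also have "\<dots> * (norm n)\<^sup>2 \<le> \<tau>\<^sup>2 * 2 * (norm n)\<^sup>2"
      using \<tau> \<open>C > 0\<close> by (intro mult_right_mono mult_left_mono) (auto simp: power_le_one)
    finally have 1: "C * (norm (h \<sigma>))\<^sup>2 \<le> C * (\<tau>\<^sup>2 * 2 * (norm n)\<^sup>2)"
      using \<open>C > 0\<close> by (intro mult_left_mono) auto
    have "n \<bullet> h \<sigma> = - (2 * C * \<tau>\<^sup>2) * (norm n)\<^sup>2"
      unfolding h_def cmod_power2 by (simp add: inner_complex_def power2_eq_square algebra_simps)
    then have "n \<bullet> h \<sigma> + C * (norm (h \<sigma>))\<^sup>2 \<le> 0" using 1 by simp
    then show ?thesis using bound[of "h \<sigma>"] unfolding X dist_norm by simp
  qed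
  have "m * norm (h 1) + m * norm (h (-1)) \<le> Re (a * h 1) + Re (a * h (-1))"
    using cone[OF hX[of 1]] cone[OF hX[of "-1"]] by simp
  also have "\<dots> = Re (a * (h 1 + h (-1)))" by (simp add: algebra_simps)
  also have "h 1 + h (-1) = of_real (- 4 * C * \<tau>\<^sup>2) * n" by (simp add: h_def)
  also have "Re (a * (of_real (- 4 * C * \<tau>\<^sup>2) * n)) \<le> norm (a * (of_real (- 4 * C * \<tau>\<^sup>2) * n))"
    by (rule complex_Re_le_cmod)
  also have "\<dots> = 4 * C * norm a * \<tau>\<^sup>2 * norm n" using \<open>C > 0\<close> by (simp add: norm_mult norm_power)
  finally have 2: "m * (norm (h 1) + norm (h (-1))) \<le> 4 * C * norm a * \<tau>\<^sup>2 * norm n"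
    by (simp add: distrib_left)
  have "h 1 - h (-1) = of_real (2 * \<tau>) * (\<i> * n)" by (simp add: h_def)
  then have "norm (h 1 - h (-1)) = 2 * \<tau> * norm n" using \<tau> by (simp add: norm_mult)
  moreover have "norm (h 1 - h (-1)) \<le> norm (h 1) + norm (h (-1))" by (rule norm_triangle_ineq4)
  ultimately have "m * (2 * \<tau> * norm n) \<le> m * (norm (h 1) + norm (h (-1)))"
    using \<open>m > 0\<close> by simp
  with 2 have "(m * 2) * (\<tau> * norm n) \<le> (4 * C * norm a * \<tau>) * (\<tau> * norm n)"
    by (simp add: power2_eq_square algebra_simps)
  then have "m * 2 \<le> 4 * C * norm a * \<tau>"
    using \<tau> \<open>n \<noteq> 0\<close> by (subst (asm) mult_le_cancel_right_pos) auto
  also have "\<dots> \<le> 4 * C * (norm a + 1) * \<tau>" using \<tau> \<open>C > 0\<close> by (simp add: algebra_simps)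
  also have "\<dots> \<le> m" by (rule \<tau>)
  finally show False using \<open>m > 0\<close> by simp
qed

lemma is_ellipse_affine_image:
  assumes "is_ellipse X" "c \<noteq> 0"
  shows "is_ellipse ((\<lambda>z. c * z + b) ` X)"
proof -
  obtain f g d where d: "dist f g < d" and X: "X = {z. dist z f + dist z g \<le> d}"
    using assms by (auto simp: is_ellipse_def)
  have dist: "dist (c * z) (c * w) = norm c * dist z w"
      "dist (c * z + b) (c * w + b) = norm c * dist z w" for z w
    by (simp_all add: dist_norm norm_mult flip: right_diff_distrib)
  have "(\<lambda>z. c * z + b) ` X = {z. dist z (c * f + b) + dist z (c * g + b) \<le> norm c * d}"
  proof (intro set_eqI iffI)
    fix w assume "w \<in> {z. dist z (c * f + b) + dist z (c * g + b) \<le> norm c * d}"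
    moreover have w: "w = c * ((w - b) / c) + b" using assms by simp
    ultimately have "norm c * (dist ((w - b) / c) f + dist ((w - b) / c) g) \<le> norm c * d"
      by (metis (no_types, lifting) dist distrib_left mem_Collect_eq)
    then have "(w - b) / c \<in> X" using assms X by simp
    then show "w \<in> (\<lambda>z. c * z + b) ` X" using w by blast
  next
    fix w assume "w \<in> (\<lambda>z. c * z + b) ` X"
    then show "w \<in> {z. dist z (c * f + b) + dist z (c * g + b) \<le> norm c * d}"
      using assms by (auto simp: X dist simp flip: distrib_left)
  qed
  moreover have "dist (c * f + b) (c * g + b) < norm c * d"
    using d assms by (simp add: dist)
  ultimately show ?thesis unfolding is_ellipse_def by blast
qed

text \<open>The foci are \<open>\<plusminus>c\<close> with \<open>c\<^sup>2 = a\<^sup>2 - b\<^sup>2\<close>; on the boundary the focal distances are \<open>a \<mp> c X\<close>.\<close>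

lemma axis_parallel_ellipse:
  assumes "0 < b" "b \<le> a"
  shows "is_ellipse {Complex (a * X) (b * Y) | X Y. X\<^sup>2 + Y\<^sup>2 \<le> 1}"
proof -
  define c where "c = sqrt (a\<^sup>2 - b\<^sup>2)"
  have c2: "c\<^sup>2 = a\<^sup>2 - b\<^sup>2" using assms by (simp add: c_def power_mono)
  have c: "0 \<le> c" "c < a"
  proof -
    show "0 \<le> c" using assms by (simp add: c_def power_mono)
    show "c < a" using assms by (intro power2_less_imp_less[of c a]) (simp_all add: c2)
  qed
  have foc: "(norm (Complex (a * X) (b * Y) - complex_of_real (\<sigma> * c)))\<^sup>2 = (a - \<sigma> * c * X)\<^sup>2 + b\<^sup>2 * (X\<^sup>2 + Y\<^sup>2 - 1)"
    if "\<sigma>\<^sup>2 = 1" for \<sigma> X Y :: real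
  proof -
    have "(norm (Complex (a * X) (b * Y) - complex_of_real (\<sigma> * c)))\<^sup>2 = (a * X - \<sigma> * c)\<^sup>2 + (b * Y)\<^sup>2"
      by (simp add: cmod_power2)
    also have "\<dots> = (a - \<sigma> * c * X)\<^sup>2 + (X\<^sup>2 - 1) * (a\<^sup>2 - \<sigma>\<^sup>2 * c\<^sup>2) + b\<^sup>2 * Y\<^sup>2"
      by (simp add: power2_eq_square algebra_simps)
    finally show ?thesis using that by (simp add: c2 algebra_simps)
  qed
  have "{Complex (a * X) (b * Y) | X Y. X\<^sup>2 + Y\<^sup>2 \<le> 1} = {z. dist z (complex_of_real c) + dist z (complex_of_real (-c)) \<le> 2 * a}"
  proof (intro set_eqI iffI)
    fix z assume "z \<in> {Complex (a * X) (b * Y) | X Y. X\<^sup>2 + Y\<^sup>2 \<le> 1}"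
    then obtain X Y where z: "z = Complex (a * X) (b * Y)" and XY: "X\<^sup>2 + Y\<^sup>2 \<le> 1" by auto
    have "X\<^sup>2 \<le> 1" using XY zero_le_power2[of Y] by linarith
    then have "\<bar>X\<bar> \<le> 1" by (simp only: abs_square_le_1)
    have le: "norm (z - complex_of_real (\<sigma> * c)) \<le> a - \<sigma> * c * X" if "\<sigma> = 1 \<or> \<sigma> = -1" for \<sigma>
    proof (rule power2_le_imp_le)
      have "b\<^sup>2 * (X\<^sup>2 + Y\<^sup>2 - 1) \<le> 0" using XY by (simp add: mult_le_0_iff)
      then show "(norm (z - complex_of_real (\<sigma> * c)))\<^sup>2 \<le> (a - \<sigma> * c * X)\<^sup>2"
        using that foc[of \<sigma> X Y] unfolding z by (auto simp del: of_real_mult)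
      have "\<bar>\<sigma> * c * X\<bar> \<le> c" using that \<open>\<bar>X\<bar> \<le> 1\<close> c by (auto simp: abs_mult mult_left_le)
      then show "0 \<le> a - \<sigma> * c * X" using c by simp
    qed
    show "z \<in> {z. dist z (complex_of_real c) + dist z (complex_of_real (-c)) \<le> 2 * a}"
      using le[of 1] le[of "-1"] by (simp add: dist_norm)
  next
    fix z assume z: "z \<in> {z. dist z (complex_of_real c) + dist z (complex_of_real (-c)) \<le> 2 * a}"
    define X Y where "X = Re z / a" "Y = Im z / b"
    have zXY: "z = Complex (a * X) (b * Y)" using assms by (simp add: X_Y_def complex_eq_iff)
    have "X\<^sup>2 + Y\<^sup>2 \<le> 1"
    proof (rule ccontr)
      assume "\<not> X\<^sup>2 + Y\<^sup>2 \<le> 1"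
      then have pos: "b\<^sup>2 * (X\<^sup>2 + Y\<^sup>2 - 1) > 0" using assms by simp
      have "a - \<sigma> * c * X < norm (z - complex_of_real (\<sigma> * c))" if "\<sigma> = 1 \<or> \<sigma> = -1" for \<sigma>
      proof (rule power2_less_imp_less)
        have "\<sigma>\<^sup>2 = 1" using that by auto
        from foc[OF this, of X Y] pos
        show "(a - \<sigma> * c * X)\<^sup>2 < (norm (z - complex_of_real (\<sigma> * c)))\<^sup>2"
          unfolding zXY by linarith
      qed simp
      from this[of 1] this[of "-1"] show False using z by (simp add: dist_norm)
    qed
    then show "z \<in> {Complex (a * X) (b * Y) | X Y. X\<^sup>2 + Y\<^sup>2 \<le> 1}" using zXY by blast
  qed
  moreover have "dist (complex_of_real c) (of_real (-c)) < 2 * a"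
    using c by (simp add: dist_norm flip: of_real_add)
  ultimately show ?thesis unfolding is_ellipse_def by blast
qed

text \<open>The singular value decomposition of \<open>T\<close>. Let \<open>p\<close> and \<open>q\<close> represent the real and imaginary part of
  \<open>T\<close>. Then \<open>\<Sum>b. (T b)\<^sup>2 = |p|\<^sup>2 - |q|\<^sup>2 + 2 \<i> \<langle>p, q\<rangle>\<close>, and a rotation of the target plane makes this
  number real and non-negative; then \<open>p\<close> and \<open>q\<close> are orthogonal with \<open>|q| \<le> |p|\<close>, and the image has
  semi-axes \<open>|p|\<close> and \<open>|q|\<close>. Dimension three leaves a direction orthogonal to \<open>p\<close> and \<open>q\<close>, along
  which each point of the ball moves to the sphere with the same image.\<close>

lemma linear_image_of_sphere_is_ellipse:
  fixes T :: "'a::euclidean_space \<Rightarrow> complex"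
  assumes T: "linear T" "surj T" and dim: "DIM('a) \<ge> 3"
  shows "is_ellipse (T ` sphere 0 1)"
proof -
  define D where "D = (\<Sum>b\<in>Basis. (T b)\<^sup>2)"
  define \<gamma> where "\<gamma> = (if D = 0 then 1 else csqrt (cnj (sgn D)))"
  have \<gamma>: "norm \<gamma> = 1" by (simp add: \<gamma>_def norm_sgn norm_csqrt)
  have \<gamma>D: "\<gamma>\<^sup>2 * D = of_real (norm D)" by (simp add: \<gamma>_def cnj_sgn_mult)
  define T' where "T' v = \<gamma> * T v" for v
  have lin: "linear T'"
    unfolding T'_def by (intro linear_compose[OF T(1), unfolded o_def] linear_times)
  have surj: "\<exists>v. T' v = z" for z
  proof -
    obtain v where "T v = z / \<gamma>" using T(2) by (metis surjD)
    then have "T' v = z" using \<gamma> by (auto simp: T'_def)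
    then show ?thesis ..
  qed
  define p q where "p = adjoint T' 1" "q = adjoint T' \<i>"
  have pq: "p \<bullet> v = Re (T' v)" "q \<bullet> v = Im (T' v)" for v
    using adjoint_works[OF lin, of v 1] adjoint_works[OF lin, of v \<i>]
    by (simp_all add: p_q_def inner_commute inner_complex_def)
  have "(\<Sum>b\<in>Basis. (T' b)\<^sup>2) = of_real (norm D)"
    using \<gamma>D by (simp add: T'_def D_def power_mult_distrib sum_distrib_left)
  moreover have "Re (\<Sum>b\<in>Basis. (T' b)\<^sup>2) = p \<bullet> p - q \<bullet> q"
    unfolding euclidean_inner[of p p] euclidean_inner[of q q]
    by (simp add: pq power2_eq_square sum_subtractf)
  moreover have "Im (\<Sum>b\<in>Basis. (T' b)\<^sup>2) = 2 * (p \<bullet> q)"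
    unfolding euclidean_inner[of p q]
    by (simp add: pq power2_eq_square sum_distrib_left mult_ac)
  ultimately have "p \<bullet> p - q \<bullet> q = norm D" and orth: "p \<bullet> q = 0" by simp_all
  then have "q \<bullet> q \<le> p \<bullet> p" using norm_ge_zero[of D] by linarith
  then have le: "norm q \<le> norm p" by (simp add: norm_le)
  obtain v\<^sub>0 where "T' v\<^sub>0 = \<i>" using surj by blast
  then have "q \<noteq> 0" using pq(2)[of v\<^sub>0] by auto
  define a b where "a = norm p" "b = norm q"
  have ab: "0 < b" "b \<le> a" using le \<open>q \<noteq> 0\<close> by (simp_all add: a_b_def)
  have sq: "p \<bullet> p = a\<^sup>2" "q \<bullet> q = b\<^sup>2" by (simp_all add: a_b_def power2_norm_eq_inner)
  have "dim {p, q} < DIM('a)"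
  proof -
    have "dim {p, q} \<le> card {p, q}" by (rule dim_le_card') simp
    also have "\<dots> \<le> 2" by (simp add: card_insert_if)
    finally show ?thesis using dim by simp
  qed
  then obtain r where r: "r \<noteq> 0" "\<And>y. y \<in> span {p, q} \<Longrightarrow> orthogonal r y"
    using orthogonal_to_subspace_exists by blast
  then have r': "p \<bullet> r = 0" "q \<bullet> r = 0" using r(2)[of p] r(2)[of q]
    by (simp_all add: orthogonal_def inner_commute span_base)
  have "T' ` sphere 0 1 = {Complex (a * X) (b * Y) | X Y. X\<^sup>2 + Y\<^sup>2 \<le> 1}"
  proof (intro set_eqI iffI)
    fix z assume "z \<in> T' ` sphere 0 1"
    then obtain v where v: "norm v = 1" "z = T' v" by auto
    define X Y where "X = (p \<bullet> v) / a" "Y = (q \<bullet> v) / b"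
    have XY: "p \<bullet> v = a * X" "q \<bullet> v = b * Y" using ab by (simp_all add: X_Y_def)
    \<comment> \<open>Bessel's inequality for the orthogonal vectors \<open>p\<close> and \<open>q\<close>\<close>
    define w where "w = v - (X / a) *\<^sub>R p - (Y / b) *\<^sub>R q"
    have vv: "v \<bullet> v = 1" using v by (simp flip: power2_norm_eq_inner)
    have "w \<bullet> w = v \<bullet> v - 2 * (X / a) * (p \<bullet> v) - 2 * (Y / b) * (q \<bullet> v)
        + (X / a)\<^sup>2 * (p \<bullet> p) + (Y / b)\<^sup>2 * (q \<bullet> q) + 2 * (X / a) * (Y / b) * (p \<bullet> q)"
      unfolding w_def
      by (simp add: inner_diff_left inner_diff_right power2_eq_square 
          inner_commute[of v p] inner_commute[of v q] inner_commute[of q p] algebra_simps)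
    also have "\<dots> = 1 - X\<^sup>2 - Y\<^sup>2"
      using ab by (simp add: vv XY sq orth power2_eq_square)
    finally have "0 \<le> 1 - X\<^sup>2 - Y\<^sup>2" by (metis inner_ge_zero)
    moreover have "z = Complex (a * X) (b * Y)" using v XY by (simp add: complex_eq_iff pq)
    ultimately show "z \<in> {Complex (a * X) (b * Y) | X Y. X\<^sup>2 + Y\<^sup>2 \<le> 1}" by force
  next
    fix z assume "z \<in> {Complex (a * X) (b * Y) | X Y. X\<^sup>2 + Y\<^sup>2 \<le> 1}"
    then obtain X Y where z: "z = Complex (a * X) (b * Y)" and XY: "X\<^sup>2 + Y\<^sup>2 \<le> 1" by auto
    define u where "u = sgn r"
    have u: "u \<bullet> u = 1" "p \<bullet> u = 0" "q \<bullet> u = 0"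
      using r(1) r' by (simp_all add: u_def sgn_div_norm norm_sgn flip: power2_norm_eq_inner)
    define s where "s = sqrt (1 - X\<^sup>2 - Y\<^sup>2)"
    have s: "s * s = 1 - X\<^sup>2 - Y\<^sup>2" using XY by (simp add: s_def)
    define v where "v = (X / a) *\<^sub>R p + (Y / b) *\<^sub>R q + s *\<^sub>R u"
    have "v \<bullet> v = (X / a)\<^sup>2 * (p \<bullet> p) + (Y / b)\<^sup>2 * (q \<bullet> q) + s * s * (u \<bullet> u)
        + 2 * (X / a) * (Y / b) * (p \<bullet> q) + 2 * (X / a) * s * (p \<bullet> u) + 2 * (Y / b) * s * (q \<bullet> u)"
      unfolding v_def
      by (simp add: inner_add_left inner_add_right power2_eq_square inner_commute[of u p]
          inner_commute[of u q] inner_commute[of q p] algebra_simps)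
    then have "v \<bullet> v = 1" using ab by (simp add: s sq orth u power2_eq_square)
    then have "norm v = 1" by (simp add: norm_eq_1)
    moreover have "T' v = z"
    proof (rule complex_eqI)
      show "Re (T' v) = Re z" "Im (T' v) = Im z"
        using ab unfolding pq[symmetric] z v_def
        by (simp_all add: inner_add_right sq orth u inner_commute[of q p] power2_eq_square)
    qed
    ultimately show "z \<in> T' ` sphere 0 1" by force
  qed
  then have "is_ellipse (T' ` sphere 0 1)" using axis_parallel_ellipse[OF ab] by simp
  moreover have "T ` sphere 0 1 = (\<lambda>z. (1 / \<gamma>) * z + 0) ` (T' ` sphere 0 1)"
    using \<gamma> by (auto simp: image_image T'_def)
  moreover have "1 / \<gamma> \<noteq> 0" using \<gamma> by auto
  ultimately show ?thesis by (metis is_ellipse_affine_image)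
qed

section \<open>Flat boundary portions as pairs of maximisers\<close>

lemma line_direction:
  assumes "a \<noteq> 0" "Re (a * z) = 0"
  shows "\<exists>t::real. z = t *\<^sub>R (\<i> / a)"
proof -
  have "a * z = of_real (Im (a * z)) * \<i>" using assms(2) by (simp add: complex_eq_iff)
  then have "z = Im (a * z) *\<^sub>R (\<i> / a)"
    using assms(1) by (simp add: scaleR_conv_of_real field_simps)
  then show ?thesis by blast
qed

text \<open>A supporting line at the midpoint of a segment in the boundary contains the whole segment.
  Conversely, the intersection of \<open>X\<close> with a supporting line is a segment, and it is maximal because
  a longer one would lie on the same line.\<close>

lemma flat_boundary_portion_iff:
  assumes "convex X" "compact X"
  shows "(\<exists>S. flat_boundary_portion S X) \<longleftrightarrow>
    (\<exists>a z1 z2. a \<noteq> 0 \<and> z1 \<in> X \<and> z2 \<in> X \<and> z1 \<noteq> z2 \<and> Re (a * z1) = Re (a * z2) \<and>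
      (\<forall>z\<in>X. Re (a * z) \<le> Re (a * z1)))"
    (is "?flat \<longleftrightarrow> ?two")
proof
  assume ?flat
  then obtain p r where pr: "p \<noteq> r" "closed_segment p r \<subseteq> frontier X"
    by (auto simp: flat_boundary_portion_def is_segment_def)
  have fr: "frontier X \<subseteq> X" using assms(2) compact_imp_closed frontier_subset_closed by blast
  have "midpoint p r \<in> frontier X" using pr by auto
  then obtain a where a: "a \<noteq> 0" "\<And>z. z \<in> X \<Longrightarrow> Re (a * z) \<le> Re (a * midpoint p r)"
    using frontier_supporting_line[OF assms(1)] fr by blast
  have average: "P = R \<and> M = P" if "M = (P + R) / 2" "P \<le> M" "R \<le> M" for P R M :: real
    using that by auto
  have "Re (a * midpoint p r) = (Re (a * p) + Re (a * r)) / 2"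
    by (simp add: midpoint_def scaleR_conv_of_real algebra_simps add_divide_distrib diff_divide_distrib)
  moreover have pX: "p \<in> X" "r \<in> X" using pr fr by auto
  ultimately have "Re (a * p) = Re (a * r) \<and> Re (a * midpoint p r) = Re (a * p)"
    using a(2)[OF pX(1)] a(2)[OF pX(2)] by (intro average)
  then show ?two using pr(1) a pX by metis
next
  assume ?two
  then obtain a z1 z2 where a: "a \<noteq> 0" and z: "z1 \<in> X" "z2 \<in> X" "z1 \<noteq> z2" "Re (a * z1) = Re (a * z2)"
    and max: "\<And>z. z \<in> X \<Longrightarrow> Re (a * z) \<le> Re (a * z1)" by blast
  define L where "L = {z. Re (a * z) = Re (a * z1)}"
  have L: "L = {z. cnj a \<bullet> z = cnj a \<bullet> z1}" by (simp add: L_def inner_complex_Re del: times_complex.simps)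
  have "convex L" "closed L" 
    by (simp_all add: L convex_hyperplane closed_hyperplane)
  have "collinear (X \<inter> L)"
  proof -
    have "collinear L" unfolding collinear_def
    proof (rule exI[of _ "\<i> / a"], intro ballI)
      fix x y assume "x \<in> L" "y \<in> L"
      then have "Re (a * (x - y)) = 0" by (simp add: L_def right_diff_distrib del: times_complex.simps)
      then show "\<exists>c. x - y = c *\<^sub>R (\<i> / a)" using line_direction a by blast
    qed
    then show ?thesis by (rule collinear_subset) simp
  qed
  moreover have "X \<inter> L \<noteq> {}" using z by (auto simp: L_def)
  moreover have "compact (X \<inter> L)" "convex (X \<inter> L)"
    using assms \<open>convex L\<close> \<open>closed L\<close> by (auto intro: convex_Int compact_Int_closed)
  ultimately obtain p r where pr: "X \<inter> L = closed_segment p r"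
    using compact_convex_collinear_segment by metis
  have "z1 \<in> X \<inter> L" "z2 \<in> X \<inter> L" using z by (simp_all add: L_def)
  then have "p \<noteq> r" using \<open>z1 \<noteq> z2\<close> pr by auto
  have "flat_boundary_portion (X \<inter> L) X"
    unfolding flat_boundary_portion_def
  proof (intro conjI allI impI)
    show "is_segment (X \<inter> L)" using pr \<open>p \<noteq> r\<close> by (auto simp: is_segment_def)
    show "X \<inter> L \<subseteq> frontier X"
      using a max by (auto intro!: maximiser_in_frontier[of a] simp: L_def)
    fix T assume T: "is_segment T \<and> X \<inter> L \<subseteq> T \<and> T \<subseteq> frontier X"
    then obtain u v where uv: "u \<noteq> v" "T = closed_segment u v" by (auto simp: is_segment_def)
    have TX: "T \<subseteq> X"
      using T assms(2) compact_imp_closed frontier_subset_closed by blast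
    have "z1 \<in> closed_segment u v" "z2 \<in> closed_segment u v"
      using T \<open>z1 \<in> X \<inter> L\<close> \<open>z2 \<in> X \<inter> L\<close> uv by blast+
    then obtain s t where s: "z1 = (1 - s) *\<^sub>R u + s *\<^sub>R v" and t: "z2 = (1 - t) *\<^sub>R u + t *\<^sub>R v"
      unfolding in_segment by blast
    have "z1 - z2 = (s - t) *\<^sub>R (v - u)" unfolding s t by (simp add: algebra_simps)
    moreover have "Re (a * (z1 - z2)) = 0" using z(4) by (simp add: right_diff_distrib del: times_complex.simps)
    ultimately have "(s - t) * Re (a * (v - u)) = 0" by (simp del: times_complex.simps)
    moreover have "s \<noteq> t" using z(3) s t by auto
    ultimately have 0: "Re (a * (v - u)) = 0" by simp
    have "w \<in> L" if "w \<in> T" for w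
    proof -
      obtain k where "w = (1 - k) *\<^sub>R u + k *\<^sub>R v" using \<open>w \<in> T\<close> uv by (auto simp: in_segment)
      then have "w - z1 = (k - s) *\<^sub>R (v - u)" unfolding s by (simp add: algebra_simps)
      then have "Re (a * (w - z1)) = (k - s) * Re (a * (v - u))"
        by (simp del: times_complex.simps)
      then show ?thesis using 0 by (simp add: L_def right_diff_distrib del: times_complex.simps)
    qed
    then show "T = X \<inter> L" using TX T by blast
  qed
  then show ?flat by blast
qed

section \<open>Unitary coordinates and normal eigenvectors\<close>

text \<open>The four vectors \<open>u\<close>, \<open>\<i> u\<close>, \<open>v\<close>, \<open>\<i> v\<close> do not span \<open>\<complex>\<^sup>3\<close> over the reals, and a vector that is
  orthogonal to \<open>x\<close> and \<open>\<i> x\<close> for the real inner product is orthogonal to \<open>x\<close> for the complex one.\<close>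

lemma exists_orthogonal_unit:
  fixes u v :: "complex^3"
  shows "\<exists>w. norm w = 1 \<and> cscalar_prod u w = 0 \<and> cscalar_prod v w = 0"
proof -
  have "dim {u, \<i> *s u, v, \<i> *s v} \<le> card {u, \<i> *s u, v, \<i> *s v}" by (rule dim_le_card') simp
  also have "\<dots> \<le> 4" by (simp add: card_insert_if)
  finally have "dim {u, \<i> *s u, v, \<i> *s v} < DIM(complex^3)" by simp
  then obtain r where r: "r \<noteq> 0" "\<And>y. y \<in> span {u, \<i> *s u, v, \<i> *s v} \<Longrightarrow> orthogonal r y"
    using orthogonal_to_subspace_exists by blast
  have 0: "cscalar_prod x r = 0" if "x \<bullet> r = 0" "(\<i> *s x) \<bullet> r = 0" for x
  proof (rule complex_eqI)
    show "Re (cscalar_prod x r) = Re 0" using that by (simp add: Re_cscalar_prod)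
    show "Im (cscalar_prod x r) = Im 0"
      using that(2) by (simp add: cscalar_prod_scale_left flip: Re_cscalar_prod)
  qed
  have "cscalar_prod u r = 0" "cscalar_prod v r = 0"
  proof -
    have "y \<bullet> r = 0" if "y \<in> {u, \<i> *s u, v, \<i> *s v}" for y
      using r(2)[OF span_base[OF that]] by (simp add: orthogonal_def inner_commute)
    then show "cscalar_prod u r = 0" "cscalar_prod v r = 0" by (simp_all add: 0)
  qed
  moreover have "norm (complex_of_real (1 / norm r) *s r) = 1"
    using r(1) by (simp add: norm_scale norm_divide)
  ultimately show ?thesis
    by (intro exI[of _ "complex_of_real (1 / norm r) *s r"]) (simp add: cscalar_prod_scale_right)
qed

definition frame :: "complex^3 \<Rightarrow> complex^3 \<Rightarrow> complex^3 \<Rightarrow> complex^3^3" where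
  "frame u v w = transpose (vector [u, v, w])"

definition orthonormal3 :: "complex^3 \<Rightarrow> complex^3 \<Rightarrow> complex^3 \<Rightarrow> bool" where
  "orthonormal3 u v w \<longleftrightarrow> norm u = 1 \<and> norm v = 1 \<and> norm w = 1 \<and>
    cscalar_prod u v = 0 \<and> cscalar_prod u w = 0 \<and> cscalar_prod v w = 0"

lemma cscalar_prod_0_commute: "cscalar_prod x y = 0 \<Longrightarrow> cscalar_prod y x = 0"
  by (metis cnj_cscalar_prod complex_cnj_zero)

lemma orthonormal3D:
  assumes "orthonormal3 u v w"
  shows "cscalar_prod u u = 1" "cscalar_prod v v = 1" "cscalar_prod w w = 1"
    "cscalar_prod u v = 0" "cscalar_prod u w = 0" "cscalar_prod v w = 0"
    "cscalar_prod v u = 0" "cscalar_prod w u = 0" "cscalar_prod w v = 0"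
    "norm u = 1" "norm v = 1" "norm w = 1"
  using assms cscalar_prod_0_commute
  by (auto simp: orthonormal3_def cscalar_prod_self_eq_1)

lemma orthonormal3_extend:
  assumes "norm u = 1" "norm v = 1" "cscalar_prod u v = 0"
  shows "\<exists>w. orthonormal3 u v w"
  using exists_orthogonal_unit[of u v] assms by (auto simp: orthonormal3_def)

lemma frame_mult: "frame u v w *v x = x $ 1 *s u + x $ 2 *s v + x $ 3 *s w"
  by (simp add: frame_def vec_eq_iff matrix_vector_mult_def sum_3 transpose_def mult.commute)

lemma conj_frame_entry:
  "(herm_adjoint (frame u v w) ** A ** frame u v w) $ i $ j
    = cscalar_prod (vector [u, v, w] $ i) (A *v (vector [u, v, w] $ j))"
  by (simp add: frame_def herm_adjoint_def transpose_def matrix_matrix_mult_def cscalar_prod_def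
      matrix_vector_mult_def sum_3 algebra_simps)

lemma unitary_frame:
  assumes "orthonormal3 u v w"
  shows "unitary_matrix (frame u v w)"
proof -
  have "herm_adjoint (frame u v w) ** frame u v w = mat 1"
  proof -
    have "(herm_adjoint (frame u v w) ** frame u v w) $ i $ j
        = cscalar_prod (vector [u, v, w] $ i) (vector [u, v, w] $ j)" for i j
      using conj_frame_entry[of u v w "mat 1" i j] by simp
    then show ?thesis
      using orthonormal3D[OF assms] by (simp add: vec_eq_iff forall_3 mat_def)
  qed
  then show ?thesis unfolding unitary_matrix_def by (metis matrix_left_right_inverse)
qed

lemma unitary_cscalar_prod:
  assumes "unitary_matrix U"
  shows "cscalar_prod (U *v x) (U *v y) = cscalar_prod x y"
  using assms by (simp add: unitary_matrix_def matrix_vector_mul_assoc flip: cscalar_prod_adjoint_right)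

lemma unitary_norm:
  assumes "unitary_matrix U"
  shows "norm (U *v x) = norm x"
proof -
  have "complex_of_real ((norm (U *v x))\<^sup>2) = complex_of_real ((norm x)\<^sup>2)"
    unfolding cscalar_prod_self[symmetric] by (rule unitary_cscalar_prod[OF assms])
  then show ?thesis by (simp only: of_real_eq_iff power2_eq_iff_nonneg norm_ge_zero)
qed

lemma unitary_cancel:
  assumes "unitary_matrix U"
  shows "U *v (herm_adjoint U *v x) = x" "herm_adjoint U *v (U *v x) = x"
  using assms by (simp_all add: unitary_matrix_def matrix_vector_mul_assoc)

lemma unitary_herm_adjoint: "unitary_matrix U \<Longrightarrow> unitary_matrix (herm_adjoint U)"
  by (simp add: unitary_matrix_def)

text \<open>Affine maps of the plane and unitary similarity together; for unitary \<open>U\<close> they act on the numerical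
  range through the affine map alone.\<close>

definition affine_conj :: "complex \<Rightarrow> complex \<Rightarrow> complex^'n^'n \<Rightarrow> complex^'n^'n \<Rightarrow> complex^'n^'n" where
  "affine_conj c b U A = mat c ** (herm_adjoint U ** A ** U) + mat b"

lemma affine_conj_mult:
  "affine_conj c b U A *v x = c *s (herm_adjoint U *v (A *v (U *v x))) + b *s x"
  unfolding affine_conj_def affine_vector_mult by (simp flip: matrix_vector_mul_assoc)

lemma herm_adjoint_mult: "herm_adjoint (A ** B) = herm_adjoint B ** herm_adjoint A"
  by (simp add: herm_adjoint_def matrix_matrix_mult_def vec_eq_iff mult.commute)

lemma herm_adjoint_mat: "herm_adjoint (mat c) = mat (cnj c)"
  by (simp add: herm_adjoint_def mat_def vec_eq_iff)

lemma herm_adjoint_add: "herm_adjoint (A + B) = herm_adjoint A + herm_adjoint B"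
  by (simp add: herm_adjoint_def vec_eq_iff)

lemma herm_adjoint_affine_conj_mult:
  "herm_adjoint (affine_conj c b U A) *v x
    = cnj c *s (herm_adjoint U *v (herm_adjoint A *v (U *v x))) + cnj b *s x"
  unfolding affine_conj_def
  by (simp add: herm_adjoint_mult herm_adjoint_add herm_adjoint_mat matrix_vector_mult_add_rdistrib
      mat_vector_mult matrix_vector_mult_scale flip: matrix_vector_mul_assoc)

lemma qform_affine_conj:
  "qform (affine_conj c b U A) x = c * qform A (U *v x) + b * of_real ((norm x)\<^sup>2)"
  by (simp add: qform_def affine_conj_mult cscalar_prod_simps cscalar_prod_adjoint_right cscalar_prod_self)

lemma affine_conj_inverse:
  assumes "unitary_matrix U" "c \<noteq> 0"
  shows "affine_conj (1 / c) (- b / c) (herm_adjoint U) (affine_conj c b U A) = A"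
  unfolding matrix_eq
  using assms by (simp add: affine_conj_mult unitary_cancel matrix_vector_right_distrib
      matrix_vector_mult_scale)

lemma numerical_range_affine_conj:
  assumes "unitary_matrix U"
  shows "numerical_range (affine_conj c b U A) = (\<lambda>z. c * z + b) ` numerical_range A"
proof -
  have "(*v) U ` sphere 0 1 = sphere 0 1"
  proof (intro set_eqI iffI)
    fix x assume "x \<in> sphere (0 :: complex^'a) 1"
    then have "herm_adjoint U *v x \<in> sphere 0 1" "x = U *v (herm_adjoint U *v x)"
      using assms by (simp_all add: unitary_cancel unitary_norm unitary_herm_adjoint)
    then show "x \<in> (*v) U ` sphere 0 1" by blast
  qed (use assms in \<open>auto simp: unitary_norm\<close>)
  then have "numerical_range A = (\<lambda>x. qform A (U *v x)) ` sphere 0 1"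
    unfolding numerical_range_eq by (metis image_image)
  then show ?thesis
    unfolding numerical_range_eq by (auto simp: qform_affine_conj image_iff)
qed

text \<open>The zero vector is included; where it must be excluded, a separate assumption does so.\<close>

definition normal_eigenvector :: "complex^'n^'n \<Rightarrow> complex \<Rightarrow> complex^'n \<Rightarrow> bool" where
  "normal_eigenvector A \<alpha> x \<longleftrightarrow> A *v x = \<alpha> *s x \<and> herm_adjoint A *v x = cnj \<alpha> *s x"

lemma normal_eigenvector_affine_conj:
  assumes "unitary_matrix U" "c \<noteq> 0" "normal_eigenvector (affine_conj c b U A) \<mu> x"
  shows "normal_eigenvector A ((\<mu> - b) / c) (U *v x)"
proof -
  have *: "B *v (U *v x) = ((\<nu> - e) / d) *s (U *v x)"
    if "d *s (herm_adjoint U *v (B *v (U *v x))) + e *s x = \<nu> *s x" "d \<noteq> 0" for B d e \<nu>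
  proof -
    have "d *s (herm_adjoint U *v (B *v (U *v x))) = (\<nu> - e) *s x"
      using that(1) by (simp add: vec_eq_iff algebra_simps)
    then have "(1 / d) *s (d *s (herm_adjoint U *v (B *v (U *v x)))) = (1 / d) *s ((\<nu> - e) *s x)" by simp
    then have "herm_adjoint U *v (B *v (U *v x)) = ((\<nu> - e) / d) *s x"
      using \<open>d \<noteq> 0\<close> by (simp add: vec_eq_iff diff_divide_distrib left_diff_distrib)
    then have "U *v (herm_adjoint U *v (B *v (U *v x))) = U *v (((\<nu> - e) / d) *s x)" by simp
    then show ?thesis using assms(1) by (simp add: unitary_cancel matrix_vector_mult_scale)
  qed
  show ?thesis
    using assms(3) *[of c A b \<mu>] *[of "cnj c" "herm_adjoint A" "cnj b" "cnj \<mu>"] assms(2)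
    unfolding normal_eigenvector_def affine_conj_mult herm_adjoint_affine_conj_mult by simp
qed

lemma normal_eigenvector_unit:
  assumes "normal_eigenvalue A \<alpha>"
  shows "\<exists>x. norm x = 1 \<and> normal_eigenvector A \<alpha> x"
proof -
  obtain x where x: "x \<noteq> 0" "A *v x = \<alpha> *s x" "herm_adjoint A *v x = cnj \<alpha> *s x"
    using assms by (auto simp: normal_eigenvalue_def)
  then show ?thesis
    by (intro exI[of _ "complex_of_real (1 / norm x) *s x"])
      (simp add: normal_eigenvector_def norm_scale norm_divide matrix_vector_mult_scale mult.commute)
qed

lemma normal_eigenvalueI:
  "normal_eigenvector A \<alpha> x \<Longrightarrow> x \<noteq> 0 \<Longrightarrow> normal_eigenvalue A \<alpha>"
  by (auto simp: normal_eigenvector_def normal_eigenvalue_def)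

lemma axis_vector_mult: "B *v axis k 1 = column k (B :: complex^'n^'m)"
  by (simp add: vec_eq_iff matrix_vector_mult_def axis_def column_def if_distrib cong: if_cong)

text \<open>The 1-by-1 block of a reduced matrix belongs to a normal eigenvector, and conversely the orthogonal
  complement of a normal eigenvector is invariant under \<open>A\<close> and \<open>A\<^sup>*\<close>.\<close>

lemma unitarily_reducible_iff: "unitarily_reducible A \<longleftrightarrow> (\<exists>\<alpha>. normal_eigenvalue A \<alpha>)"
proof
  assume "unitarily_reducible A"
  then obtain U where U: "unitary_matrix U" and blk: "block_diagonal3 (herm_adjoint U ** A ** U)"
    by (auto simp: unitarily_reducible_def unitarily_similar_def)
  define B where "B = herm_adjoint U ** A ** U"
  have "B = affine_conj 1 0 U A"
    unfolding matrix_eq affine_conj_mult B_def by (simp flip: matrix_vector_mul_assoc)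
  moreover have "\<exists>k. normal_eigenvector B (B $ k $ k) (axis k 1)"
  proof -
    have "normal_eigenvector B (B $ 1 $ 1) (axis 1 1) \<or> normal_eigenvector B (B $ 3 $ 3) (axis 3 1)"
      using blk unfolding block_diagonal3_def B_def[symmetric] normal_eigenvector_def
      unfolding axis_vector_mult
      by (auto simp: vec_eq_iff forall_3 column_def herm_adjoint_def axis_def)
    then show ?thesis by blast
  qed
  ultimately obtain k where "normal_eigenvector A (B $ k $ k) (U *v axis k 1)"
    using normal_eigenvector_affine_conj[OF U, of 1 0 A] by auto
  moreover have "U *v axis k 1 \<noteq> 0"
    using unitary_norm[OF U, of "axis k 1"] by auto
  ultimately show "\<exists>\<alpha>. normal_eigenvalue A \<alpha>" using normal_eigenvalueI by blast
next
  assume "\<exists>\<alpha>. normal_eigenvalue A \<alpha>"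
  then obtain \<alpha> u where u: "norm u = 1" "normal_eigenvector A \<alpha> u"
    using normal_eigenvector_unit by blast
  obtain v where v: "norm v = 1" "cscalar_prod u v = 0"
    using exists_orthogonal_unit by blast
  then obtain w where o: "orthonormal3 u v w" using orthonormal3_extend u by blast
  have "cscalar_prod u (A *v x) = \<alpha> * cscalar_prod u x" for x
    using u unfolding normal_eigenvector_def cscalar_prod_adjoint_left[symmetric]
    by (simp add: cscalar_prod_simps)
  moreover have "A *v u = \<alpha> *s u" using u by (simp add: normal_eigenvector_def)
  ultimately have "block_diagonal3 (herm_adjoint (frame u v w) ** A ** frame u v w)"
    using orthonormal3D[OF o] unfolding block_diagonal3_def conj_frame_entry
    by (simp add: cscalar_prod_simps)
  then show "unitarily_reducible A"
    using unitary_frame[OF o] unfolding unitarily_reducible_def unitarily_similar_def by blast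
qed

lemma normal_eigenvector_inner:
  assumes "normal_eigenvector A \<alpha> u"
  shows "cscalar_prod u (A *v x) = \<alpha> * cscalar_prod u x" "cscalar_prod x (A *v u) = \<alpha> * cscalar_prod x u"
proof -
  show "cscalar_prod u (A *v x) = \<alpha> * cscalar_prod u x"
    using assms unfolding normal_eigenvector_def cscalar_prod_adjoint_left[symmetric]
    by (simp add: cscalar_prod_simps)
  show "cscalar_prod x (A *v u) = \<alpha> * cscalar_prod x u"
    using assms by (simp add: normal_eigenvector_def cscalar_prod_simps)
qed

lemma qform_normal_eigenvector:
  "normal_eigenvector A \<alpha> u \<Longrightarrow> norm u = 1 \<Longrightarrow> qform A u = \<alpha>"
  by (simp add: qform_def normal_eigenvector_inner cscalar_prod_self)

lemma normal_eigenvectors_orthogonal: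
  assumes "normal_eigenvector A \<alpha> u" "normal_eigenvector A \<beta> v" "\<alpha> \<noteq> \<beta>"
  shows "cscalar_prod u v = 0"
  using normal_eigenvector_inner(1)[OF assms(1), of v] normal_eigenvector_inner(2)[OF assms(2), of u] assms(3)
  by simp

lemma orthonormal3_expand:
  assumes "orthonormal3 u v w"
  shows "x = cscalar_prod u x *s u + cscalar_prod v x *s v + cscalar_prod w x *s w"
proof -
  have "herm_adjoint (frame u v w) *v x = vector [cscalar_prod u x, cscalar_prod v x, cscalar_prod w x]"
    by (simp add: frame_def herm_adjoint_def transpose_def matrix_vector_mult_def cscalar_prod_def
        vec_eq_iff forall_3 sum_3)
  then show ?thesis
    using unitary_cancel(1)[OF unitary_frame[OF assms], of x] by (simp add: frame_mult)
qed

lemma orthonormal3_parseval: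
  assumes "orthonormal3 u v w"
  shows "(norm x)\<^sup>2 = (norm (cscalar_prod u x))\<^sup>2 + (norm (cscalar_prod v x))\<^sup>2 + (norm (cscalar_prod w x))\<^sup>2"
proof -
  have "cscalar_prod x x = cscalar_prod x (cscalar_prod u x *s u + cscalar_prod v x *s v + cscalar_prod w x *s w)"
    using orthonormal3_expand[OF assms, of x] by simp
  also have "\<dots> = of_real ((norm (cscalar_prod u x))\<^sup>2 + (norm (cscalar_prod v x))\<^sup>2 + (norm (cscalar_prod w x))\<^sup>2)"
    unfolding of_real_add complex_norm_square by (simp add: cscalar_prod_simps cnj_cscalar_prod)
  finally show ?thesis unfolding cscalar_prod_self of_real_eq_iff .
qed

lemma qform_two_normal_eigenvectors:
  assumes o: "orthonormal3 u v w" and u: "normal_eigenvector A \<alpha> u" and v: "normal_eigenvector A \<beta> v"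
  shows "qform A x = of_real ((norm (cscalar_prod u x))\<^sup>2) * \<alpha> + of_real ((norm (cscalar_prod v x))\<^sup>2) * \<beta>
    + of_real ((norm (cscalar_prod w x))\<^sup>2) * qform A w"
proof -
  have "qform A (c *s u + d *s v + e *s w)
      = of_real ((norm c)\<^sup>2) * \<alpha> + of_real ((norm d)\<^sup>2) * \<beta> + of_real ((norm e)\<^sup>2) * qform A w" for c d e
    unfolding complex_norm_square
    using orthonormal3D[OF o]
    by (simp add: qform_def matrix_vector_right_distrib matrix_vector_mult_scale cscalar_prod_simps
        normal_eigenvector_inner[OF u] normal_eigenvector_inner[OF v] algebra_simps)
  then show ?thesis using orthonormal3_expand[OF o, of x] by metis
qed

text \<open>The complement of two orthogonal normal eigenvectors is invariant under \<open>A\<close> and \<open>A\<^sup>*\<close>, and it is a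
  line.\<close>

lemma third_normal_eigenvector:
  assumes o: "orthonormal3 u v w" and u: "normal_eigenvector A \<alpha> u" and v: "normal_eigenvector A \<beta> v"
  shows "normal_eigenvector A (qform A w) w"
proof -
  have *: "B *v w = cscalar_prod w (B *v w) *s w"
    if "cscalar_prod u (B *v w) = 0" "cscalar_prod v (B *v w) = 0" for B
    using orthonormal3_expand[OF o, of "B *v w"] that by simp
  have "A *v w = qform A w *s w"
    using *[of A] orthonormal3D[OF o] by (simp add: normal_eigenvector_inner[OF u] normal_eigenvector_inner[OF v] qform_def)
  moreover have "herm_adjoint A *v w = cscalar_prod w (herm_adjoint A *v w) *s w"
    using u v orthonormal3D[OF o]
    by (intro *) (simp_all add: cscalar_prod_adjoint_right normal_eigenvector_def cscalar_prod_simps)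
  moreover have "cscalar_prod w (herm_adjoint A *v w) = cnj (qform A w)"
    by (simp add: cscalar_prod_adjoint_right qform_def cnj_cscalar_prod)
  ultimately show ?thesis by (simp add: normal_eigenvector_def)
qed

text \<open>With two normal eigenvalues \<open>\<alpha> \<noteq> \<beta>\<close> the matrix is normal and its numerical range is the convex
  hull of \<open>\<alpha>\<close>, \<open>\<beta>\<close> and a third number \<open>\<gamma>\<close>. A functional that is constant on the line through \<open>\<alpha>\<close> and
  \<open>\<beta>\<close>, with the sign for which \<open>\<gamma>\<close> does not exceed this constant, is maximal at both \<open>\<alpha>\<close> and \<open>\<beta>\<close>,
  which strict convexity forbids.\<close>

lemma normal_eigenvalue_unique:
  fixes A :: "complex^3^3"
  assumes E: "is_ellipse (numerical_range A)" and "normal_eigenvalue A \<alpha>" "normal_eigenvalue A \<beta>"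
  shows "\<alpha> = \<beta>"
proof (rule ccontr)
  assume "\<alpha> \<noteq> \<beta>"
  obtain u v where u: "norm u = 1" "normal_eigenvector A \<alpha> u" and v: "norm v = 1" "normal_eigenvector A \<beta> v"
    using assms normal_eigenvector_unit by metis
  obtain w where o: "orthonormal3 u v w"
    using orthonormal3_extend[OF u(1) v(1) normal_eigenvectors_orthogonal[OF u(2) v(2) \<open>\<alpha> \<noteq> \<beta>\<close>]] by blast
  \<comment> \<open>\<open>z \<mapsto> Re (b z)\<close> is constant along the line through \<open>\<alpha>\<close> and \<open>\<beta>\<close>\<close>
  define b where "b = \<i> * cnj (\<alpha> - \<beta>)"
  define a where "a = (if Re (b * qform A w) \<le> Re (b * \<alpha>) then b else - b)"
  have "Re (b * (\<alpha> - \<beta>)) = 0" by (simp add: b_def)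
  then have eq: "Re (a * \<beta>) = Re (a * \<alpha>)" by (simp add: a_def right_diff_distrib del: times_complex.simps)
  have w_le: "Re (a * qform A w) \<le> Re (a * \<alpha>)" by (simp add: a_def del: times_complex.simps)
  have "Re (a * z) \<le> Re (a * \<alpha>)" if "z \<in> numerical_range A" for z
  proof -
    obtain x where x: "norm x = 1" "z = qform A x" using \<open>z \<in> _\<close> by (auto simp: numerical_range_eq)
    define p q r where "p = (norm (cscalar_prod u x))\<^sup>2" "q = (norm (cscalar_prod v x))\<^sup>2" "r = (norm (cscalar_prod w x))\<^sup>2"
    have "z = of_real p * \<alpha> + of_real q * \<beta> + of_real r * qform A w"
      unfolding x p_q_r_def by (rule qform_two_normal_eigenvectors[OF o u(2) v(2)])
    then have "a * z = p *\<^sub>R (a * \<alpha>) + q *\<^sub>R (a * \<beta>) + r *\<^sub>R (a * qform A w)"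
      by (simp add: scaleR_conv_of_real algebra_simps)
    then have "Re (a * z) = p * Re (a * \<alpha>) + q * Re (a * \<alpha>) + r * Re (a * qform A w)"
      by (simp add: eq del: times_complex.simps)
    also have "\<dots> \<le> p * Re (a * \<alpha>) + q * Re (a * \<alpha>) + r * Re (a * \<alpha>)"
      by (intro add_left_mono mult_left_mono w_le) (simp add: p_q_r_def)
    also have "\<dots> = (p + q + r) * Re (a * \<alpha>)" by (simp add: distrib_right)
    also have "p + q + r = 1" using orthonormal3_parseval[OF o, of x] x by (simp add: p_q_r_def)
    finally show ?thesis by simp
  qed
  moreover have "\<alpha> \<in> numerical_range A" "\<beta> \<in> numerical_range A"
    using numerical_rangeI u v qform_normal_eigenvector by metis+
  moreover have "a \<noteq> 0" using \<open>\<alpha> \<noteq> \<beta>\<close> by (simp add: a_def b_def)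
  ultimately have "\<alpha> = \<beta>" using ellipse_maximiser_unique[OF E] eq by blast
  then show False using \<open>\<alpha> \<noteq> \<beta>\<close> by simp
qed

lemma the_normal_eigenvalue_eq:
  fixes A :: "complex^3^3"
  assumes "is_ellipse (numerical_range A)" "normal_eigenvalue A \<alpha>"
  shows "the_normal_eigenvalue A = \<alpha>"
  unfolding the_normal_eigenvalue_def
  using assms(2) normal_eigenvalue_unique[OF assms(1)] by (intro the_equality) blast+

section \<open>Invariance under affine maps and unitary similarity\<close>

lemma E3_iff: "A \<in> E3 \<longleftrightarrow> (\<forall>\<alpha>. \<not> normal_eigenvalue A \<alpha>) \<and> is_ellipse (numerical_range A)"
  by (simp add: E3_def unitarily_reducible_iff)

lemma F3_iff: "A \<in> F3 \<longleftrightarrow> (\<forall>\<alpha>. \<not> normal_eigenvalue A \<alpha>) \<and>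
    (\<exists>a z1 z2. a \<noteq> 0 \<and> z1 \<in> numerical_range A \<and> z2 \<in> numerical_range A \<and> z1 \<noteq> z2 \<and>
      Re (a * z1) = Re (a * z2) \<and> (\<forall>z\<in>numerical_range A. Re (a * z) \<le> Re (a * z1)))"
  by (simp add: F3_def unitarily_reducible_iff
      flat_boundary_portion_iff[OF Toeplitz_Hausdorff compact_numerical_range])

lemma normal_eigenvalue_affine_conj:
  assumes "unitary_matrix U" "c \<noteq> 0" "normal_eigenvalue (affine_conj c b U A) \<mu>"
  shows "\<exists>\<alpha>. normal_eigenvalue A \<alpha>"
proof -
  obtain x where x: "norm x = 1" "normal_eigenvector (affine_conj c b U A) \<mu> x"
    using normal_eigenvector_unit assms(3) by blast
  have "U *v x \<noteq> 0" using unitary_norm[OF assms(1), of x] x(1) by auto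
  then show ?thesis using normal_eigenvector_affine_conj[OF assms(1,2) x(2)] normal_eigenvalueI by blast
qed

text \<open>With \<open>closure_affine_conj\<close> this makes it enough to approximate a matrix in normal form.\<close>

lemma E3_affine_conj:
  assumes "A \<in> E3" "unitary_matrix U" "c \<noteq> 0"
  shows "affine_conj c b U A \<in> E3"
  using assms normal_eigenvalue_affine_conj is_ellipse_affine_image
  unfolding E3_iff by (metis numerical_range_affine_conj)

lemma F3_affine_conj:
  assumes "A \<in> F3" "unitary_matrix U" "c \<noteq> 0"
  shows "affine_conj c b U A \<in> F3"
proof -
  obtain a z1 z2 where "a \<noteq> 0" and z: "z1 \<in> numerical_range A" "z2 \<in> numerical_range A" "z1 \<noteq> z2"
      "Re (a * z1) = Re (a * z2)" "\<forall>z\<in>numerical_range A. Re (a * z) \<le> Re (a * z1)"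
    using assms(1) unfolding F3_iff by blast
  have shift: "a / c * (c * z + b) = a * z + a * b / c" for z
    using assms(3) by (simp add: field_simps)
  have "a / c \<noteq> 0" using \<open>a \<noteq> 0\<close> assms(3) by simp
  moreover have "c * z1 + b \<in> numerical_range (affine_conj c b U A)" "c * z2 + b \<in> numerical_range (affine_conj c b U A)"
    using z unfolding numerical_range_affine_conj[OF assms(2)] by blast+
  moreover have "c * z1 + b \<noteq> c * z2 + b" using z assms(3) by simp
  moreover have "Re (a / c * (c * z1 + b)) = Re (a / c * (c * z2 + b))"
    unfolding shift using z(4) by simp
  moreover have "\<forall>z\<in>numerical_range (affine_conj c b U A). Re (a / c * z) \<le> Re (a / c * (c * z1 + b))"
    unfolding numerical_range_affine_conj[OF assms(2)] ball_simps shift using z(5) by simp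
  ultimately show ?thesis
    using assms(1) normal_eigenvalue_affine_conj[OF assms(2,3)] unfolding F3_iff by blast
qed

lemma closure_affine_conj:
  assumes "A \<in> closure S" "\<And>B. B \<in> S \<Longrightarrow> affine_conj c b U B \<in> S"
  shows "affine_conj c b U A \<in> closure S"
proof -
  obtain f where f: "\<And>n. f n \<in> S" "f \<longlonglongrightarrow> A" using assms(1) unfolding closure_sequential by blast
  have "(\<lambda>n. affine_conj c b U (f n)) \<longlonglongrightarrow> affine_conj c b U A"
    unfolding affine_conj_def by (intro tendsto_intros f)
  then show ?thesis using f(1) assms(2) unfolding closure_sequential
    by (intro exI[of _ "\<lambda>n. affine_conj c b U (f n)"]) simp
qed

section \<open>Irreducible matrices with elliptical range or with a flat portion\<close>

text \<open>For \<open>e = 0\<close> and \<open>l = - cnj k\<close> this is the normal form of the reducible matrices in question.\<close>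

definition ellipse_family :: "complex \<Rightarrow> complex \<Rightarrow> complex \<Rightarrow> complex \<Rightarrow> complex^3^3" where
  "ellipse_family e k l t = vector [vector [0, 0, 0], vector [0, 0, k], vector [e, l, t]]"

text \<open>For \<open>r = e = 0\<close> this is the same normal form; the perturbation keeps the off-diagonal part
  skew-hermitian.\<close>

definition flat_family :: "real \<Rightarrow> complex \<Rightarrow> complex \<Rightarrow> complex \<Rightarrow> complex^3^3" where
  "flat_family r e k t = vector [vector [\<i> * r, 0, e], vector [0, 0, k], vector [- cnj e, - cnj k, t]]"

lemma ellipse_family_irreducible:
  assumes "e \<noteq> 0" "k \<noteq> 0" "l \<noteq> 0"
  shows "\<not> normal_eigenvalue (ellipse_family e k l t) \<alpha>"
proof
  assume "normal_eigenvalue (ellipse_family e k l t) \<alpha>"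
  then obtain x where x: "x \<noteq> 0" "ellipse_family e k l t *v x = \<alpha> *s x"
      "herm_adjoint (ellipse_family e k l t) *v x = cnj \<alpha> *s x"
    by (auto simp: normal_eigenvalue_def)
  then have "\<alpha> * x $ 1 = 0" "k * x $ 3 = \<alpha> * x $ 2" "e * x $ 1 + l * x $ 2 + t * x $ 3 = \<alpha> * x $ 3"
      "cnj e * x $ 3 = cnj \<alpha> * x $ 1" "cnj l * x $ 3 = cnj \<alpha> * x $ 2"
      "cnj k * x $ 2 + cnj t * x $ 3 = cnj \<alpha> * x $ 3"
    by (simp_all add: ellipse_family_def vec_eq_iff forall_3 herm_adjoint_def matrix_vector_mult_def sum_3)
  note eqs = this
  have "x $ 3 = 0" using eqs(1,4) assms(1) by auto
  moreover have "x $ 2 = 0" using eqs(6) calculation assms(2) by simp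
  moreover have "x $ 1 = 0" using eqs(3) calculation assms(1) by simp
  ultimately show False using x(1) by (simp add: vec_eq_iff forall_3)
qed

text \<open>A Hopf map: \<open>x \<mapsto> (2 |x\<^sub>3|\<^sup>2 - 1, 2 x\<^sub>1 cnj x\<^sub>3, 2 x\<^sub>2 cnj x\<^sub>3)\<close> sends the unit sphere of \<open>\<complex>\<^sup>3\<close> onto the unit
  sphere of \<open>\<real> \<times> \<complex>\<^sup>2\<close>, and the quadratic form of the matrix is an affine function of the image
  because the upper left 2-by-2 block vanishes.\<close>

lemma numerical_range_ellipse_family:
  "numerical_range (ellipse_family e k l t) = (\<lambda>z. (1/2) * z + t / 2) `
    ((\<lambda>(s, y, z). of_real s * t + e * y + k * cnj z + l * z) ` sphere (0 :: real \<times> complex \<times> complex) 1)"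
    (is "_ = ?aff ` (?T ` _)")
proof -
  have q: "qform (ellipse_family e k l t) x
      = k * (cnj (x $ 2) * x $ 3) + e * (x $ 1 * cnj (x $ 3)) + l * (x $ 2 * cnj (x $ 3)) + t * of_real ((norm (x $ 3))\<^sup>2)" for x
    unfolding complex_norm_square
    by (simp add: qform_def ellipse_family_def cscalar_prod_def matrix_vector_mult_def sum_3 algebra_simps)
  have norm3: "(norm x)\<^sup>2 = (norm (x $ 1))\<^sup>2 + (norm (x $ 2))\<^sup>2 + (norm (x $ 3))\<^sup>2" for x :: "complex^3"
    by (simp add: norm_vec_def L2_set_def sum_3)
  have normp: "(norm (s, y, z))\<^sup>2 = s\<^sup>2 + (norm y)\<^sup>2 + (norm z)\<^sup>2" for s :: real and y z :: complex
    by (simp add: norm_Pair)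
  have one: "norm v = 1 \<longleftrightarrow> (norm v)\<^sup>2 = 1" for v :: "'z::real_normed_vector"
    by (metis norm_ge_zero one_power2 power2_eq_iff_nonneg zero_le_one)
  show ?thesis
  proof (intro set_eqI iffI)
    fix w assume "w \<in> numerical_range (ellipse_family e k l t)"
    then obtain x where x: "norm x = 1" "w = qform (ellipse_family e k l t) x"
      by (auto simp: numerical_range_eq)
    define s where "s = 2 * (norm (x $ 3))\<^sup>2 - 1"
    define y z where "y = 2 * (x $ 1 * cnj (x $ 3))" "z = 2 * (x $ 2 * cnj (x $ 3))"
    have "(norm (x $ 1))\<^sup>2 + (norm (x $ 2))\<^sup>2 = 1 - (norm (x $ 3))\<^sup>2"
      using norm3[of x] x(1) by simp
    then have "4 * (norm (x $ 3))\<^sup>2 * ((norm (x $ 1))\<^sup>2 + (norm (x $ 2))\<^sup>2) = 4 * (norm (x $ 3))\<^sup>2 * (1 - (norm (x $ 3))\<^sup>2)"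
      by simp
    moreover have "(norm y)\<^sup>2 + (norm z)\<^sup>2 = 4 * (norm (x $ 3))\<^sup>2 * ((norm (x $ 1))\<^sup>2 + (norm (x $ 2))\<^sup>2)"
      by (simp add: y_z_def norm_mult power_mult_distrib algebra_simps)
    moreover have "s\<^sup>2 = 1 - 4 * (norm (x $ 3))\<^sup>2 * (1 - (norm (x $ 3))\<^sup>2)"
      by (simp add: s_def power2_eq_square algebra_simps)
    ultimately have "norm (s, y, z) = 1" unfolding one normp by linarith
    moreover have "w = ?aff (?T (s, y, z))"
    proof -
      have half: "k * b + e * p + l * q + t * N
          = (1 / 2) * ((2 * N - 1) * t + e * (2 * p) + k * (2 * b) + l * (2 * q)) + t / 2" for b p q N :: complex
        by (simp add: algebra_simps)
      have "of_real s = 2 * complex_of_real ((norm (x $ 3))\<^sup>2) - 1" by (simp add: s_def)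
      moreover have "cnj z = 2 * (cnj (x $ 2) * x $ 3)" by (simp add: y_z_def)
      ultimately show ?thesis unfolding x q half by (simp only: prod.case y_z_def)
    qed
    moreover from \<open>norm (s, y, z) = 1\<close> have "?T (s, y, z) \<in> ?T ` sphere 0 1" by (intro imageI) simp
    ultimately show "w \<in> ?aff ` (?T ` sphere 0 1)" by - (rule image_eqI)
  next
    fix w assume "w \<in> ?aff ` (?T ` sphere 0 1)"
    then obtain s y z where n: "norm (s, y, z) = 1" and w: "w = ?aff (?T (s, y, z))" by force
    have n2: "s\<^sup>2 + (norm y)\<^sup>2 + (norm z)\<^sup>2 = 1" using n unfolding one normp .
    have "s\<^sup>2 \<le> 1" using n2 zero_le_power2[of "norm y"] zero_le_power2[of "norm z"] by linarith
    then have "\<bar>s\<bar> \<le> 1" by (simp only: abs_square_le_1)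
    then have s: "-1 \<le> s" "s \<le> 1" by auto
    obtain x where "norm x = 1" "w = qform (ellipse_family e k l t) x"
    \<comment> \<open>over the pole \<open>s = -1\<close>, where \<open>x\<^sub>3 = 0\<close>, the first coordinate vector is a preimage\<close>
    proof (cases "s = -1")
      case True
      then have "y = 0" "z = 0" using n2 by (simp_all add: add_nonneg_eq_0_iff)
      then have "w = qform (ellipse_family e k l t) (axis 1 1)"
        using True by (simp add: w q axis_def)
      then show ?thesis using that[of "axis 1 1"] by simp
    next
      case False
      define r where "r = sqrt ((1 + s) / 2)"
      have r: "r > 0" "r\<^sup>2 = (1 + s) / 2" using False s by (simp_all add: r_def)
      \<comment> \<open>the preimage whose last coordinate is positive\<close>
      define x :: "complex^3" where "x = vector [y / of_real (2 * r), z / of_real (2 * r), of_real r]"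
      have "(norm x)\<^sup>2 = ((norm y)\<^sup>2 + (norm z)\<^sup>2) / (4 * r\<^sup>2) + r\<^sup>2"
        unfolding norm3 using r by (simp add: x_def norm_divide norm_mult power_divide power_mult_distrib add_divide_distrib)
      also have "(norm y)\<^sup>2 + (norm z)\<^sup>2 = (1 - s) * (1 + s)"
        using n2 by (simp add: power2_eq_square algebra_simps)
      also have "\<dots> / (4 * r\<^sup>2) + r\<^sup>2 = 1"
        unfolding r(2) using False s by (simp add: field_simps)
      finally have "norm x = 1" unfolding one .
      moreover have "w = qform (ellipse_family e k l t) x"
      proof -
        have N: "(norm (x $ 3))\<^sup>2 = (1 + s) / 2" using r by (simp add: x_def)
        have P: "x $ 1 * cnj (x $ 3) = y / 2" "x $ 2 * cnj (x $ 3) = z / 2"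
            "cnj (x $ 2) * x $ 3 = cnj z / 2"
          using r(1) by (simp_all add: x_def)
        show ?thesis unfolding w q prod.case N P
          by (simp add: add_divide_distrib distrib_left mult.commute)
      qed
      ultimately show ?thesis using that by blast
    qed
    then show "w \<in> numerical_range (ellipse_family e k l t)" using numerical_rangeI by blast
  qed
qed

lemma ellipse_family_in_E3:
  assumes "e \<noteq> 0" "k \<noteq> 0" "l \<noteq> 0"
  shows "ellipse_family e k l t \<in> E3"
proof -
  define T where "T = (\<lambda>(s, y, z). of_real s * t + e * y + k * cnj z + l * z :: complex)"
  have "linear T"
    unfolding T_def by (rule linearI) (auto simp: scaleR_conv_of_real algebra_simps)
  moreover have "surj T"
  proof (rule surjI)
    show "T (0, w / e, 0) = w" for w using assms by (simp add: T_def)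
  qed
  moreover have "DIM(real \<times> complex \<times> complex) \<ge> 3" by simp
  ultimately have "is_ellipse (T ` sphere 0 1)" by (rule linear_image_of_sphere_is_ellipse)
  then have "is_ellipse (numerical_range (ellipse_family e k l t))"
    unfolding numerical_range_ellipse_family T_def by (rule is_ellipse_affine_image) simp
  then show ?thesis using ellipse_family_irreducible[OF assms] by (simp add: E3_iff)
qed

text \<open>The real part of the form is \<open>Re t |x\<^sub>3|\<^sup>2\<close>, so the imaginary axis is a supporting line; the first two
  coordinate vectors give the points \<open>\<i> r\<close> and 0 on it. A normal eigenvector is an eigenvector
  of the hermitian part, so it is a multiple of the third coordinate vector or has \<open>x\<^sub>3 = 0\<close>; the
  skew-hermitian part has no eigenvector of either kind.\<close>

lemma flat_family_in_F3:
  assumes "r \<noteq> 0" "e \<noteq> 0" "k \<noteq> 0" "Re t > 0"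
  shows "flat_family r e k t \<in> F3"
proof -
  let ?A = "flat_family r e k t"
  have "\<not> normal_eigenvalue ?A \<alpha>" for \<alpha>
  proof
    assume "normal_eigenvalue ?A \<alpha>"
    then obtain x where x: "x \<noteq> 0" "?A *v x = \<alpha> *s x" "herm_adjoint ?A *v x = cnj \<alpha> *s x"
      by (auto simp: normal_eigenvalue_def)
    then have eqs: "\<i> * r * x $ 1 + e * x $ 3 = \<alpha> * x $ 1" "k * x $ 3 = \<alpha> * x $ 2"
        "- cnj e * x $ 1 - cnj k * x $ 2 + t * x $ 3 = \<alpha> * x $ 3"
        "- \<i> * r * x $ 1 - e * x $ 3 = cnj \<alpha> * x $ 1" "- k * x $ 3 = cnj \<alpha> * x $ 2"
        "cnj e * x $ 1 + cnj k * x $ 2 + cnj t * x $ 3 = cnj \<alpha> * x $ 3"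
      by (simp_all add: flat_family_def vec_eq_iff forall_3 herm_adjoint_def matrix_vector_mult_def sum_3)
    have a1: "(\<alpha> + cnj \<alpha>) * x $ 1 = 0" "(\<alpha> + cnj \<alpha>) * x $ 2 = 0"
      unfolding distrib_right eqs(1,2,4,5)[symmetric] by simp_all
    have a3: "(t + cnj t) * x $ 3 = (\<alpha> + cnj \<alpha>) * x $ 3"
      unfolding distrib_right eqs(3,6)[symmetric] by (simp add: algebra_simps)
    have tt: "t + cnj t \<noteq> 0" using assms(4) by (simp add: complex_add_cnj)
    have "x $ 3 = 0"
    proof (rule ccontr)
      assume "x $ 3 \<noteq> 0"
      then have "\<alpha> + cnj \<alpha> \<noteq> 0" using a3 tt by auto
      then have "x $ 1 = 0" "x $ 2 = 0" using a1 by auto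
      then show False using eqs(1) \<open>x $ 3 \<noteq> 0\<close> assms(2) by simp
    qed
    then have "\<i> * r * x $ 1 = \<alpha> * x $ 1" "\<alpha> * x $ 2 = 0" "cnj e * x $ 1 = - cnj k * x $ 2"
      using eqs by (simp_all add: add_eq_0_iff2)
    then have "x $ 1 = 0 \<and> x $ 2 = 0" using assms(1,2,3) by auto
    then show False using x(1) \<open>x $ 3 = 0\<close> by (simp add: vec_eq_iff forall_3)
  qed
  moreover have "\<exists>a z1 z2. a \<noteq> 0 \<and> z1 \<in> numerical_range ?A \<and> z2 \<in> numerical_range ?A \<and> z1 \<noteq> z2 \<and>
      Re (a * z1) = Re (a * z2) \<and> (\<forall>z\<in>numerical_range ?A. Re (a * z) \<le> Re (a * z1))"
  proof -
    have q: "qform ?A x = \<i> * r * of_real ((norm (x $ 1))\<^sup>2) + (e * (cnj (x $ 1) * x $ 3) - cnj (e * (cnj (x $ 1) * x $ 3)))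
        + (k * (cnj (x $ 2) * x $ 3) - cnj (k * (cnj (x $ 2) * x $ 3))) + t * of_real ((norm (x $ 3))\<^sup>2)" for x
      unfolding complex_norm_square
      by (simp add: qform_def flat_family_def cscalar_prod_def matrix_vector_mult_def sum_3 algebra_simps)
    have Re_q: "Re (qform ?A x) = Re t * (norm (x $ 3))\<^sup>2" for x
    proof -
      have 1: "Re (\<i> * r * of_real ((norm (x $ 1))\<^sup>2)) = 0" by simp
      have 2: "Re (z - cnj z) = 0" for z by simp
      have 3: "Re (t * of_real ((norm (x $ 3))\<^sup>2)) = Re t * (norm (x $ 3))\<^sup>2"
        by (simp del: of_real_power)
      show ?thesis unfolding q plus_complex.sel 1 2 3 by simp
    qed
    have n: "norm (axis j 1 :: complex^3) = 1" for j by simp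
    have "\<i> * r \<in> numerical_range ?A" "0 \<in> numerical_range ?A"
      using numerical_rangeI[OF n[of 1], of ?A] numerical_rangeI[OF n[of 2], of ?A]
      by (simp_all add: q axis_def)
    moreover have "\<i> * r \<noteq> 0" using assms(1) by simp
    moreover have "Re (-1 * (\<i> * r)) = Re (-1 * 0)" by simp
    moreover have "\<forall>z\<in>numerical_range ?A. Re (-1 * z) \<le> Re (-1 * (\<i> * r))"
      using assms(4) by (auto simp: numerical_range_eq Re_q)
    moreover have "(-1 :: complex) \<noteq> 0" by simp
    ultimately show ?thesis by blast
  qed
  ultimately show ?thesis unfolding F3_iff by blast
qed

section \<open>Reducible matrices in both closures\<close>

lemma tendsto_vector3 [tendsto_intros]:
  assumes "(a \<longlongrightarrow> a') F" "(b \<longlongrightarrow> b') F" "(c \<longlongrightarrow> c') F"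
  shows "((\<lambda>n. vector [a n, b n, c n] :: 'z::{topological_space,zero}^3) \<longlongrightarrow> vector [a', b', c']) F"
proof (rule vec_tendstoI)
  show "((\<lambda>n. (vector [a n, b n, c n] :: 'z^3) $ i) \<longlongrightarrow> vector [a', b', c'] $ i) F" for i
    using exhaust_3[of i] assms by auto
qed

text \<open>The entries \<open>e\<close>, \<open>r\<close> and, in the flat case, \<open>t\<close> are increased by \<open>1 / (n + 1)\<close>; so is \<open>k\<close> if it is
  zero.\<close>

lemma canonical_in_closures:
  assumes "Re t \<ge> 0"
  shows "ellipse_family 0 k (- cnj k) t \<in> closure E3 \<inter> closure F3"
proof
  define e where "e n = complex_of_real (inverse (real (Suc n)))" for n
  have e0: "e n \<noteq> 0" for n unfolding e_def by (simp del: of_nat_Suc)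
  have "(\<lambda>n. complex_of_real (inverse (real (Suc n)))) \<longlonglongrightarrow> complex_of_real 0"
    by (intro tendsto_of_real LIMSEQ_inverse_real_of_nat)
  then have e: "e \<longlonglongrightarrow> 0" unfolding e_def[abs_def] of_real_0 .
  define k' where "k' n = (if k = 0 then e n else k)" for n
  have k0: "k' n \<noteq> 0" for n using e0 by (simp add: k'_def)
  have k': "k' \<longlonglongrightarrow> k" using e by (cases "k = 0") (simp_all add: k'_def[abs_def])
  have "(\<lambda>n. ellipse_family (e n) (k' n) (- cnj (k' n)) t) \<longlonglongrightarrow> ellipse_family 0 k (- cnj k) t"
    unfolding ellipse_family_def by (intro tendsto_intros e k')
  moreover have "ellipse_family (e n) (k' n) (- cnj (k' n)) t \<in> E3" for n
    using e0 k0 by (intro ellipse_family_in_E3) auto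
  ultimately show "ellipse_family 0 k (- cnj k) t \<in> closure E3"
    unfolding closure_sequential by (intro exI[of _ "\<lambda>n. ellipse_family (e n) (k' n) (- cnj (k' n)) t"]) simp
  have "(\<lambda>n. flat_family (inverse (real (Suc n))) (e n) (k' n) (t + e n)) \<longlonglongrightarrow> flat_family 0 0 k (t + 0)"
    unfolding flat_family_def by (intro tendsto_intros e k' LIMSEQ_inverse_real_of_nat)
  moreover have "flat_family 0 0 k (t + 0) = ellipse_family 0 k (- cnj k) t"
    by (simp add: flat_family_def ellipse_family_def)
  moreover have "flat_family (inverse (real (Suc n))) (e n) (k' n) (t + e n) \<in> F3" for n
  proof (rule flat_family_in_F3)
    have "Re (e n) = inverse (real (Suc n))" by (simp only: e_def Re_complex_of_real)
    then show "0 < Re (t + e n)" using assms by (simp add: add_nonneg_pos)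
  qed (use e0 k0 in auto)
  ultimately show "ellipse_family 0 k (- cnj k) t \<in> closure F3"
    unfolding closure_sequential
    by (intro exI[of _ "\<lambda>n. flat_family (inverse (real (Suc n))) (e n) (k' n) (t + e n)"]) simp
qed


text \<open>In an orthonormal basis \<open>u\<close>, \<open>v\<close>, \<open>w\<close> the matrix \<open>a (A - \<alpha>)\<close> has zero row and column at \<open>u\<close> and a
  zero at \<open>(v, v)\<close>. Since \<open>v\<close> minimises \<open>Re (a q)\<close>, it is an eigenvector of the hermitian part, so the
  entries at \<open>(v, w)\<close> and \<open>(w, v)\<close> are skew-hermitian partners: the matrix is in normal form.\<close>

lemma in_both_closures:
  assumes "a \<noteq> 0" "norm u = 1" "norm v = 1" "cscalar_prod u v = 0"
    and u: "normal_eigenvector A \<alpha> u" and v: "qform A v = \<alpha>"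
    and min: "\<And>y. norm y = 1 \<Longrightarrow> Re (a * \<alpha>) \<le> Re (a * qform A y)"
  shows "A \<in> closure E3 \<inter> closure F3"
proof -
  obtain w where o: "orthonormal3 u v w" using orthonormal3_extend assms by blast
  note o' = orthonormal3D[OF o]
  have "herm_part (- a) A v = of_real (2 * - Re (a * \<alpha>)) *s v"
    using min v \<open>norm v = 1\<close> by (intro maximiser_eigenvector) (auto simp del: times_complex.simps)
  then have "cscalar_prod w (herm_part (- a) A v) = 0" using o' by (simp add: cscalar_prod_simps)
  then have "- (a * cscalar_prod w (A *v v)) - cnj a * cscalar_prod (A *v w) v = 0"
    by (simp add: herm_part_def cscalar_prod_simps cscalar_prod_uminus cscalar_prod_adjoint_right)
  then have "a * cscalar_prod w (A *v v) = - (cnj a * cscalar_prod (A *v w) v)"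
    by (metis eq_iff_diff_eq_0 minus_minus)
  then have wv: "a * cscalar_prod w (A *v v) = - cnj (a * cscalar_prod v (A *v w))"
    by (simp add: cnj_cscalar_prod)
  define k where "k = a * cscalar_prod v (A *v w)"
  define t where "t = a * qform A w - a * \<alpha>"
  have "Re t \<ge> 0" using min[of w] o' by (simp add: t_def del: times_complex.simps)
  define U where "U = frame u v w"
  have U: "unitary_matrix U" unfolding U_def by (rule unitary_frame[OF o])
  have "affine_conj a (- (a * \<alpha>)) U A = ellipse_family 0 k (- cnj k) t"
  proof -
    have mat_mult: "(mat c ** M) $ i $ j = c * M $ i $ j" for c i j and M :: "complex^3^3"
      by (simp add: matrix_matrix_mult_def mat_def if_distrib if_distribR sum.delta' cong: if_cong)
    have "cscalar_prod v (A *v v) = \<alpha>" using v by (simp add: qform_def)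
    then show ?thesis
      using o' wv unfolding U_def
      by (simp add: vec_eq_iff forall_3 affine_conj_def mat_mult conj_frame_entry mat_def[of "- (a * \<alpha>)"] ellipse_family_def
          normal_eigenvector_inner[OF u] k_def t_def qform_def)
  qed
  then have C: "affine_conj a (- (a * \<alpha>)) U A \<in> closure E3 \<inter> closure F3"
    using canonical_in_closures[OF \<open>Re t \<ge> 0\<close>] by simp
  have inv: "affine_conj (1 / a) (- (- (a * \<alpha>)) / a) (herm_adjoint U) (affine_conj a (- (a * \<alpha>)) U A) = A"
    by (rule affine_conj_inverse[OF U \<open>a \<noteq> 0\<close>])
  have "1 / a \<noteq> 0" using assms by simp
  then show ?thesis
    using closure_affine_conj[of _ E3] closure_affine_conj[of _ F3] C
      E3_affine_conj F3_affine_conj unitary_herm_adjoint[OF U] inv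
    by (metis Int_iff)
qed


lemma attains_max_qform:
  "\<exists>x. norm x = 1 \<and> (\<forall>y. norm y = 1 \<longrightarrow> Re (a * qform A y) \<le> Re (a * qform A (x :: complex^3)))"
proof -
  have "continuous_on (sphere 0 1) (\<lambda>y. Re (a * qform A y))"
    unfolding continuous_on_def by (auto intro!: tendsto_intros simp del: times_complex.simps)
  moreover have "sphere (0 :: complex^3) 1 \<noteq> {}" using norm_axis_1[of 1] by (auto simp: mem_sphere_0 intro!: exI[of _ "axis 1 1"])
  ultimately obtain x where "x \<in> sphere 0 1" "\<forall>y\<in>sphere 0 1. Re (a * qform A y) \<le> Re (a * qform A (x :: complex^3))"
    using continuous_attains_sup[OF compact_sphere] by blast
  then show ?thesis by (intro exI[of _ x]) (simp del: times_complex.simps)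
qed

text \<open>The hermitian parts of \<open>a A\<close> and \<open>\<i> a A\<close> together determine \<open>A\<close> and \<open>A\<^sup>*\<close>.\<close>

lemma two_directions_normal_eigenvector:
  assumes "a \<noteq> 0" "norm x = 1" "herm_part a A x = s *s x" "herm_part (\<i> * a) A x = r *s x"
  shows "normal_eigenvector A (qform A x) x"
proof -
  have *: "a *s (A *v x) + cnj a *s (herm_adjoint A *v x) = s *s x"
    "\<i> * a *s (A *v x) - \<i> * cnj a *s (herm_adjoint A *v x) = r *s x"
    using assms(3,4) by (simp_all add: herm_part_def)
  have "(s - \<i> * r) *s x = s *s x - \<i> *s (r *s x)" "(s + \<i> * r) *s x = s *s x + \<i> *s (r *s x)"
    by (simp_all add: vec_eq_iff algebra_simps)
  then have "(s - \<i> * r) *s x = (2 * a) *s (A *v x)" "(s + \<i> * r) *s x = (2 * cnj a) *s (herm_adjoint A *v x)"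
    unfolding *[symmetric] by (simp_all add: vec_eq_iff algebra_simps)
  then have "(1 / (2 * a)) *s ((2 * a) *s (A *v x)) = (1 / (2 * a)) *s ((s - \<i> * r) *s x)"
    "(1 / (2 * cnj a)) *s ((2 * cnj a) *s (herm_adjoint A *v x)) = (1 / (2 * cnj a)) *s ((s + \<i> * r) *s x)"
    by simp_all
  then have "A *v x = (1 / (2 * a) * (s - \<i> * r)) *s x" "herm_adjoint A *v x = (1 / (2 * cnj a) * (s + \<i> * r)) *s x"
    using assms(1) unfolding vector_smult_assoc by simp_all
  then obtain l \<mu> where lm: "A *v x = l *s x" "herm_adjoint A *v x = \<mu> *s x" by blast
  have "l = qform A x" using assms(2) by (simp add: qform_def lm cscalar_prod_simps cscalar_prod_self)
  moreover have "\<mu> = cnj (qform A x)"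
  proof -
    have "\<mu> = cscalar_prod x (herm_adjoint A *v x)" using assms(2) by (simp add: lm cscalar_prod_simps cscalar_prod_self)
    then show ?thesis by (simp add: cscalar_prod_adjoint_right qform_def cnj_cscalar_prod)
  qed
  ultimately show ?thesis using lm by (simp add: normal_eigenvector_def)
qed

text \<open>Since \<open>Re (a q)\<close> is constant on the sphere, every unit vector is an eigenvector of the hermitian part
  of \<open>a A\<close>, so the extremal vectors \<open>p\<close>, \<open>n\<close> of \<open>Im (a q)\<close> are normal eigenvectors, and so is the vector
  \<open>w\<close> orthogonal to both. Its eigenvalue lies between the other two, hence it is also taken by \<open>q\<close> on
  a combination of \<open>p\<close> and \<open>n\<close>. If \<open>p\<close> and \<open>n\<close> have the same value, \<open>q\<close> is constant on the sphere.\<close>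

lemma collinear_range_eigenvectors:
  fixes A :: "complex^3^3"
  assumes "a \<noteq> 0" and line: "\<And>y. norm y = 1 \<Longrightarrow> Re (a * qform A y) = m"
  shows "\<exists>u v \<alpha>. norm u = 1 \<and> norm v = 1 \<and> cscalar_prod u v = 0 \<and> normal_eigenvector A \<alpha> u \<and> qform A v = \<alpha>"
proof -
  have H: "herm_part a A x = of_real (2 * m) *s x" if "norm x = 1" for x
    using line that by (intro maximiser_eigenvector) (auto simp del: times_complex.simps)
  have Re_i: "Re (\<i> * a * z) = - Im (a * z)" "Re (- \<i> * a * z) = Im (a * z)" for z by simp_all
  obtain p where p: "norm p = 1" "\<And>y. norm y = 1 \<Longrightarrow> Im (a * qform A y) \<le> Im (a * qform A p)"
    using attains_max_qform[of "- \<i> * a" A] unfolding Re_i by blast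
  obtain n where n: "norm n = 1" "\<And>y. norm y = 1 \<Longrightarrow> Im (a * qform A n) \<le> Im (a * qform A y)"
    using attains_max_qform[of "\<i> * a" A] unfolding Re_i neg_le_iff_le by blast
  have "herm_part (\<i> * a) A n = of_real (2 * - Im (a * qform A n)) *s n"
    using n by (intro maximiser_eigenvector) (simp_all only: Re_i neg_le_iff_le)
  then have n_eig: "normal_eigenvector A (qform A n) n"
    using two_directions_normal_eigenvector[OF \<open>a \<noteq> 0\<close> n(1) H[OF n(1)]] by blast
  have "herm_part (- \<i> * a) A p = of_real (2 * Im (a * qform A p)) *s p"
    using p by (intro maximiser_eigenvector) (simp_all only: Re_i neg_le_iff_le)
  moreover have "herm_part (\<i> * a) A p = - herm_part (- \<i> * a) A p"
    by (simp add: herm_part_def)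
  ultimately have "herm_part (\<i> * a) A p = (- of_real (2 * Im (a * qform A p))) *s p"
    by (simp only: vector_smult_lneg)
  then have p_eig: "normal_eigenvector A (qform A p) p"
    using two_directions_normal_eigenvector[OF \<open>a \<noteq> 0\<close> p(1) H[OF p(1)]] by blast
  have q_eq: "qform A y = qform A z" if "norm y = 1" "norm z = 1" "Im (a * qform A y) = Im (a * qform A z)" for y z
  proof -
    have "a * qform A y = a * qform A z" by (rule complex_eqI) (use that line in \<open>simp_all del: times_complex.simps\<close>)
    then show ?thesis using \<open>a \<noteq> 0\<close> by simp
  qed
  show ?thesis
  proof (cases "qform A p = qform A n")
    case True
    obtain v where v: "norm v = 1" "cscalar_prod p v = 0" using exists_orthogonal_unit by blast
    have "Im (a * qform A v) = Im (a * qform A p)" using n(2)[OF v(1)] p(2)[OF v(1)] True by (simp del: times_complex.simps)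
    then have "qform A v = qform A p" using q_eq v p by blast
    then show ?thesis using v p p_eig by blast
  next
    case False
    have "cscalar_prod p n = 0" using normal_eigenvectors_orthogonal[OF p_eig n_eig False] .
    then obtain w where o: "orthonormal3 p n w" using orthonormal3_extend p n by blast
    note o' = orthonormal3D[OF o]
    define \<mu> M M' where "\<mu> = Im (a * qform A w)" "M = Im (a * qform A p)" "M' = Im (a * qform A n)"
    note defs = this
    have between: "M' \<le> \<mu>" "\<mu> \<le> M" using n(2)[of w] p(2)[of w] o' by (simp_all add: defs del: times_complex.simps)
    have "M \<noteq> M'" using q_eq[OF p(1) n(1)] False by (auto simp: defs simp del: times_complex.simps)
    then have lt: "M' < M" using between by simp
    define s where "s = (\<mu> - M') / (M - M')"
    have s: "0 \<le> s" "s \<le> 1" using between lt by (simp_all add: s_def divide_le_eq)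
    define v where "v = complex_of_real (sqrt s) *s p + complex_of_real (sqrt (1 - s)) *s n"
    have coef: "cscalar_prod p v = of_real (sqrt s)" "cscalar_prod n v = of_real (sqrt (1 - s))" "cscalar_prod w v = 0"
      using o' by (simp_all add: v_def cscalar_prod_simps)
    have "(norm v)\<^sup>2 = 1" unfolding orthonormal3_parseval[OF o, of v] coef using s by simp
    then have "norm v = 1" by (metis norm_ge_zero one_power2 power2_eq_iff_nonneg zero_le_one)
    have "qform A v = s *\<^sub>R qform A p + (1 - s) *\<^sub>R qform A n"
      unfolding qform_two_normal_eigenvectors[OF o p_eig n_eig, of v] coef using s by (simp add: scaleR_conv_of_real)
    then have "a * qform A v = s *\<^sub>R (a * qform A p) + (1 - s) *\<^sub>R (a * qform A n)"
      by (simp only: distrib_left mult_scaleR_right)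
    then have "Im (a * qform A v) = s * M + (1 - s) * M'" by (simp add: defs del: times_complex.simps)
    also have "\<dots> = M' + s * (M - M')" by (simp add: algebra_simps)
    also have "\<dots> = \<mu>" using lt by (simp add: s_def)
    finally have "qform A v = qform A w" using \<open>norm v = 1\<close> o' by (intro q_eq) (simp_all add: defs del: times_complex.simps)
    moreover have "normal_eigenvector A (qform A w) w" by (rule third_normal_eigenvector[OF o p_eig n_eig])
    ultimately show ?thesis using o' coef(3) \<open>norm v = 1\<close> by blast
  qed
qed

lemma segment_on_line:
  "\<exists>a. a \<noteq> 0 \<and> (\<forall>z\<in>closed_segment f g. Re (a * z) = Re (a * f))"
proof -
  define a where "a = (if f = g then 1 else \<i> * cnj (g - f))"
  have 0: "Re (a * (g - f)) = 0" by (simp add: a_def)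
  have line: "Re (a * z) = Re (a * f)" if "z = (1 - t) *\<^sub>R f + t *\<^sub>R g" for t z
  proof -
    have "a * z = a * f + t *\<^sub>R (a * (g - f))" unfolding that by (simp add: scaleR_conv_of_real algebra_simps)
    then show ?thesis using 0 by (simp del: times_complex.simps)
  qed
  have "\<forall>z\<in>closed_segment f g. Re (a * z) = Re (a * f)"
  proof
    fix z assume "z \<in> closed_segment f g"
    then obtain t where "z = (1 - t) *\<^sub>R f + t *\<^sub>R g" unfolding in_segment by blast
    then show "Re (a * z) = Re (a * f)" by (rule line)
  qed
  moreover have "a \<noteq> 0" by (simp add: a_def)
  ultimately show ?thesis by blast
qed

lemma segment_range_in_closures:
  fixes A :: "complex^3^3"
  assumes "numerical_range A = closed_segment f g"
  shows "(\<exists>\<alpha>. normal_eigenvalue A \<alpha>) \<and> A \<in> closure E3 \<inter> closure F3"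
proof -
  obtain a where a: "a \<noteq> 0" "\<And>z. z \<in> numerical_range A \<Longrightarrow> Re (a * z) = Re (a * f)"
    using segment_on_line[of f g] assms by blast
  then have line: "Re (a * qform A y) = Re (a * f)" if "norm y = 1" for y using numerical_rangeI that by blast
  obtain u v \<alpha> where uv: "norm u = 1" "norm v = 1" "cscalar_prod u v = 0" "normal_eigenvector A \<alpha> u" "qform A v = \<alpha>"
    using collinear_range_eigenvectors[OF a(1) line] by blast
  have "Re (a * \<alpha>) \<le> Re (a * qform A y)" if "norm y = 1" for y
    using line[OF that] line[OF uv(2)] uv(5) by (simp del: times_complex.simps)
  then have "A \<in> closure E3 \<inter> closure F3" using in_both_closures[OF a(1) uv] by blast
  moreover have "u \<noteq> 0" using uv(1) by auto
  ultimately show ?thesis using normal_eigenvalueI[OF uv(4)] by blast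
qed


text \<open>Let \<open>\<alpha>\<close> minimise \<open>Re (a z)\<close> over \<open>W(A)\<close>. On the unit vectors orthogonal to the normal eigenvector
  \<open>u\<close> the function \<open>Re (a (q - \<alpha>))\<close> has a minimum \<open>m\<close>. If \<open>m\<close> were positive, then, with a bound \<open>C\<close>
  for \<open>|q - \<alpha>|\<close> on these vectors, \<open>Re (a (z - \<alpha>)) \<ge> (m / C) |z - \<alpha>|\<close> would hold on all of \<open>W(A)\<close>,
  since the component of a unit vector along \<open>u\<close> contributes nothing to \<open>q - \<alpha>\<close>. This is a cone; so
  \<open>m = 0\<close>, and by strict convexity the minimising vector has the value \<open>\<alpha>\<close>.\<close>

lemma ellipse_frontier_in_closures:
  fixes A :: "complex^3^3"
  assumes E: "is_ellipse (numerical_range A)" and eig: "normal_eigenvalue A \<alpha>"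
    and fr: "\<alpha> \<in> frontier (numerical_range A)"
  shows "A \<in> closure E3 \<inter> closure F3"
proof -
  obtain u where u: "norm u = 1" "normal_eigenvector A \<alpha> u" using normal_eigenvector_unit eig by blast
  have qu: "qform A u = \<alpha>" using u by (simp add: qform_normal_eigenvector)
  have \<alpha>W: "\<alpha> \<in> numerical_range A" using numerical_rangeI[of u A] u qu by simp
  obtain b where b: "b \<noteq> 0" "\<And>z. z \<in> numerical_range A \<Longrightarrow> Re (b * z) \<le> Re (b * \<alpha>)"
    using frontier_supporting_line[OF Toeplitz_Hausdorff \<alpha>W fr] by blast
  define a where "a = - b"
  have a: "Re (a * \<alpha>) \<le> Re (a * qform A y)" if "norm y = 1" for y
    using b(2)[OF numerical_rangeI[OF that]] by (simp add: a_def del: times_complex.simps)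
  have "a \<noteq> 0" using b by (simp add: a_def)
  define K where "K = sphere 0 1 \<inter> {v. cscalar_prod u v = 0}"
  have "closed {v. cscalar_prod u v = 0}"
    by (intro closed_Collect_eq) (auto simp: continuous_on_def intro!: tendsto_intros)
  then have "compact K" unfolding K_def by (intro compact_Int_closed) auto
  obtain v\<^sub>0 where "v\<^sub>0 \<in> K" using exists_orthogonal_unit[of u u] by (auto simp: K_def)
  have "continuous_on K (\<lambda>v. Re (a * (qform A v - \<alpha>)))" "continuous_on K (\<lambda>v. norm (qform A v - \<alpha>))"
    unfolding continuous_on_def by (auto intro!: tendsto_intros simp del: times_complex.simps)
  note cont = this
  obtain v where v: "v \<in> K" "\<And>y. y \<in> K \<Longrightarrow> Re (a * (qform A v - \<alpha>)) \<le> Re (a * (qform A y - \<alpha>))"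
    using continuous_attains_inf[OF \<open>compact K\<close> _ cont(1)] \<open>v\<^sub>0 \<in> K\<close> by blast
  obtain v' where v': "v' \<in> K" "\<And>y. y \<in> K \<Longrightarrow> norm (qform A y - \<alpha>) \<le> norm (qform A v' - \<alpha>)"
    using continuous_attains_sup[OF \<open>compact K\<close> _ cont(2)] \<open>v\<^sub>0 \<in> K\<close> by blast
  define m where "m = Re (a * (qform A v - \<alpha>))"
  \<comment> \<open>the summand 1 only makes \<open>C\<close> positive\<close>
  define C where "C = norm (qform A v' - \<alpha>) + 1"
  have "C > 0" unfolding C_def by (simp add: add_nonneg_pos)
  have vK: "norm v = 1" "cscalar_prod u v = 0" using v(1) by (auto simp: K_def)
  have "m \<ge> 0" using a[OF vK(1)] by (simp add: m_def right_diff_distrib del: times_complex.simps)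
  moreover have "\<not> m > 0"
  proof
    assume "m > 0"
    have "m / C * norm (z - \<alpha>) \<le> Re (a * (z - \<alpha>))" if "z \<in> numerical_range A" for z
    proof -
      obtain y where y: "norm y = 1" "z = qform A y" using \<open>z \<in> numerical_range A\<close> by (auto simp: numerical_range_eq)
      define s where "s = cscalar_prod u y"
      define w where "w = y - s *s u"
      have uw: "cscalar_prod u w = 0" using u(1) by (simp add: w_def s_def cscalar_prod_simps cscalar_prod_self)
      have wu: "cscalar_prod w u = 0" by (rule cscalar_prod_0_commute[OF uw])
      have y': "y = s *s u + w" by (simp add: w_def)
      have uu: "cscalar_prod u u = 1" using u(1) by (simp only: cscalar_prod_self_eq_1)
      have "cscalar_prod y y = s * cnj s + cscalar_prod w w"
        unfolding y' by (simp add: cscalar_prod_simps uw wu uu)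
      then have "cscalar_prod y y = of_real ((norm s)\<^sup>2 + (norm w)\<^sup>2)"
        unfolding of_real_add complex_norm_square by (simp only: cscalar_prod_self)
      then have sw: "(norm s)\<^sup>2 + (norm w)\<^sup>2 = 1" using y(1) unfolding cscalar_prod_self of_real_eq_iff by simp
      have "z = of_real ((norm s)\<^sup>2) * \<alpha> + qform A w"
        unfolding y y' qform_add qform_scale
        by (simp add: qu matrix_vector_mult_scale cscalar_prod_simps normal_eigenvector_inner[OF u(2)] uw wu)
      also have "(norm s)\<^sup>2 = 1 - (norm w)\<^sup>2" using sw by simp
      finally have z: "z - \<alpha> = qform A w - of_real ((norm w)\<^sup>2) * \<alpha>" by (simp add: algebra_simps)
      show ?thesis
      proof (cases "w = 0")
        case True
        then show ?thesis using z by (simp add: qform_def)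
      next
        case False
        define n where "n = complex_of_real (1 / norm w) *s w"
        have nK: "n \<in> K" using False uw by (simp add: n_def K_def norm_scale norm_divide cscalar_prod_simps)
        have "w = complex_of_real (norm w) *s n" using False by (simp add: n_def)
        then have "qform A w = of_real ((norm (complex_of_real (norm w)))\<^sup>2) * qform A n"
          using qform_scale by metis
        then have zn: "z - \<alpha> = (norm w)\<^sup>2 *\<^sub>R (qform A n - \<alpha>)"
          unfolding z by (simp add: scaleR_conv_of_real right_diff_distrib)
        have "m / C * norm (qform A n - \<alpha>) \<le> m / C * C"
          using v'(2)[OF nK] \<open>m > 0\<close> \<open>C > 0\<close> by (intro mult_left_mono) (simp_all add: C_def)
        also have "\<dots> = m" using \<open>C > 0\<close> by simp
        also have "\<dots> \<le> Re (a * (qform A n - \<alpha>))" unfolding m_def by (rule v(2)[OF nK])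
        finally have "(norm w)\<^sup>2 * (m / C * norm (qform A n - \<alpha>)) \<le> (norm w)\<^sup>2 * Re (a * (qform A n - \<alpha>))"
          by (rule mult_left_mono) simp
        moreover have "norm (z - \<alpha>) = (norm w)\<^sup>2 * norm (qform A n - \<alpha>)" unfolding zn by simp
        moreover have "Re (a * (z - \<alpha>)) = (norm w)\<^sup>2 * Re (a * (qform A n - \<alpha>))"
          unfolding zn by (simp del: times_complex.simps)
        ultimately show ?thesis by (simp only: mult.left_commute)
      qed
    qed
    then show False using ellipse_not_in_cone[OF E fr, of "m / C" a] \<open>m > 0\<close> \<open>C > 0\<close> by auto
  qed
  ultimately have "Re (a * (qform A v - \<alpha>)) = 0" by (simp add: m_def)
  then have "Re (b * qform A v) = Re (b * \<alpha>)" by (simp add: a_def right_diff_distrib del: times_complex.simps)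
  then have "qform A v = \<alpha>"
    using ellipse_maximiser_unique[OF E b(1) numerical_rangeI[OF vK(1)] \<alpha>W _ refl b(2)] by blast
  then show ?thesis using in_both_closures[OF \<open>a \<noteq> 0\<close> u(1) vK u(2)] a by blast
qed

section \<open>Limits of matrices with elliptical range\<close>

text \<open>Unit vectors that realise the points \<open>z n\<close> have a convergent subsequence.\<close>

lemma numerical_range_limit:
  assumes F: "F \<longlonglongrightarrow> A" and z: "z \<longlonglongrightarrow> w" and mem: "\<And>n. z n \<in> numerical_range (F n)"
  shows "w \<in> numerical_range A"
proof -
  have "\<exists>x. norm x = 1 \<and> z n = qform (F n) x" for n using mem[of n] by (auto simp: numerical_range_eq)
  then obtain x where x: "\<And>n. norm (x n) = 1" "\<And>n. z n = qform (F n) (x n)" by metis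
  have "compact (sphere (0 :: complex^'a) 1)" by simp
  moreover have "\<forall>n. x n \<in> sphere 0 1" using x by simp
  ultimately obtain l r where l: "l \<in> sphere 0 1" "strict_mono (r :: nat \<Rightarrow> nat)" "(x \<circ> r) \<longlonglongrightarrow> l"
    unfolding compact_def by blast
  have "(\<lambda>n. qform ((F \<circ> r) n) ((x \<circ> r) n)) \<longlonglongrightarrow> qform A l"
    by (intro tendsto_intros LIMSEQ_subseq_LIMSEQ[OF F] l)
  then have "(z \<circ> r) \<longlonglongrightarrow> qform A l" by (simp add: x(2) o_def)
  then have "w = qform A l" using LIMSEQ_unique LIMSEQ_subseq_LIMSEQ[OF z l(2)] by blast
  then show ?thesis using numerical_rangeI l(1) by auto
qed

lemma numerical_ranges_bounded:
  fixes A :: "complex^'n^'n"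
  assumes "F \<longlonglongrightarrow> A"
  shows "\<exists>R. \<forall>n. numerical_range (F n) \<subseteq> cball 0 R"
proof -
  have "compact (insert A (range F) \<times> sphere (0 :: complex^'n) 1)"
    by (intro compact_Times compact_sequence_with_limit[OF assms] compact_sphere)
  moreover have "continuous_on (insert A (range F) \<times> sphere (0 :: complex^'n) 1) (\<lambda>p. qform (fst p) (snd p))"
    unfolding continuous_on_def
    by (intro ballI tendsto_qform tendsto_fst tendsto_snd tendsto_ident_at)
  ultimately have "bounded ((\<lambda>p. qform (fst p) (snd p)) ` (insert A (range F) \<times> sphere 0 1))"
    using compact_continuous_image compact_imp_bounded by blast
  then obtain R where R: "\<And>z. z \<in> (\<lambda>p. qform (fst p) (snd p)) ` (insert A (range F) \<times> sphere 0 1) \<Longrightarrow> norm z \<le> R"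
    unfolding bounded_iff by blast
  have "norm z \<le> R" if "z \<in> numerical_range (F n)" for n z
    using that by (intro R) (force simp: numerical_range_eq)
  then show ?thesis by (intro exI[of _ R]) auto
qed

text \<open>The foci and major axes of the approximating ellipses stay bounded, so along a subsequence they
  converge. Points of the limit numerical range satisfy the limit inequality. Conversely, a point of a
  non-degenerate limit ellipse is a limit of interior points, which belong to all late approximants;
  in the degenerate case the limit is the segment between the limit foci, which belong to the convex
  set \<open>W(A)\<close>.\<close>

lemma closure_E3_numerical_range:
  assumes "A \<in> closure E3"
  shows "\<exists>f g d. dist f g \<le> d \<and> numerical_range A = {z. dist z f + dist z g \<le> d}"
proof -
  obtain F where F: "\<And>n. F n \<in> E3" "F \<longlonglongrightarrow> A" using assms unfolding closure_sequential by blast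
  have "\<forall>n. \<exists>t. dist (fst t) (fst (snd t)) < snd (snd t) \<and>
      numerical_range (F n) = {z. dist z (fst t) + dist z (fst (snd t)) \<le> (snd (snd t) :: real)}"
    using F(1) by (auto simp: E3_def is_ellipse_def)
  from choice[OF this] obtain t where t: "\<And>n. dist (fst (t n)) (fst (snd (t n))) < snd (snd (t n))"
      "\<And>n. numerical_range (F n) = {z. dist z (fst (t n)) + dist z (fst (snd (t n))) \<le> snd (snd (t n))}"
    by blast
  obtain R where R: "\<And>n. numerical_range (F n) \<subseteq> cball 0 R" using numerical_ranges_bounded[OF F(2)] by blast
  have tb: "t n \<in> cball 0 R \<times> cball 0 R \<times> {0..6 * R}" for n
  proof -
    obtain p q e where pqe: "t n = (p, q, e)" by (metis prod_cases3)
    have lt: "dist p q < e" and W: "numerical_range (F n) = {z. dist z p + dist z q \<le> e}"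
      using t[of n] by (simp_all add: pqe)
    \<comment> \<open>a point of the ellipse whose distance from \<open>p\<close> bounds the major axis\<close>
    define w where "w = p + of_real ((e - dist p q) / 2)"
    have wp: "dist w p = (e - dist p q) / 2" using lt unfolding w_def dist_norm by (simp del: of_real_divide of_real_diff)
    have "dist w q \<le> dist w p + dist p q" by (rule dist_triangle)
    then have "w \<in> numerical_range (F n)" "p \<in> numerical_range (F n)" "q \<in> numerical_range (F n)"
      using lt wp by (simp_all add: W dist_commute)
    then have "norm w \<le> R" "norm p \<le> R" "norm q \<le> R" using R[of n] by auto
    moreover have "dist w p \<le> norm w + norm p" "dist p q \<le> norm p + norm q"
      unfolding dist_norm by (rule norm_triangle_ineq4)+
    moreover have "0 \<le> e" using lt zero_le_dist[of p q] by linarith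
    ultimately show ?thesis using wp by (simp add: pqe)
  qed
  have "compact (cball 0 R \<times> cball 0 R \<times> {0..6 * R} :: (complex \<times> complex \<times> real) set)"
    by (intro compact_Times compact_cball compact_Icc)
  then obtain l r where r: "strict_mono (r :: nat \<Rightarrow> nat)" "(t \<circ> r) \<longlonglongrightarrow> l"
    using tb unfolding compact_def by blast
  obtain p q e where l: "l = (p, q, e)" by (metis prod_cases3)
  define P Q D where "P n = fst (t (r n))" "Q n = fst (snd (t (r n)))" "D n = snd (snd (t (r n)))" for n
  note PQD = this
  have lim: "P \<longlonglongrightarrow> p" "Q \<longlonglongrightarrow> q" "D \<longlonglongrightarrow> e"
    using tendsto_fst[OF r(2)] tendsto_fst[OF tendsto_snd[OF r(2)]] tendsto_snd[OF tendsto_snd[OF r(2)]]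
    by (simp_all add: l PQD[abs_def] o_def)
  define G where "G = F \<circ> r"
  have G: "G \<longlonglongrightarrow> A" unfolding G_def by (rule LIMSEQ_subseq_LIMSEQ[OF F(2) r(1)])
  have W: "numerical_range (G n) = {z. dist z (P n) + dist z (Q n) \<le> D n}" and lt: "dist (P n) (Q n) < D n" for n
    using t[of "r n"] by (simp_all add: G_def PQD)
  have le: "dist p q \<le> e"
    by (rule LIMSEQ_le[OF tendsto_dist[OF lim(1,2)] lim(3)]) (use lt less_imp_le in blast)
  have "numerical_range A = {z. dist z p + dist z q \<le> e}"
  proof (intro set_eqI iffI)
    fix z assume "z \<in> numerical_range A"
    then obtain x where x: "norm x = 1" "z = qform A x" by (auto simp: numerical_range_eq)
    have "(\<lambda>n. qform (G n) x) \<longlonglongrightarrow> z" unfolding x by (intro tendsto_intros G)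
    then have "(\<lambda>n. dist (qform (G n) x) (P n) + dist (qform (G n) x) (Q n)) \<longlonglongrightarrow> dist z p + dist z q"
      by (intro tendsto_intros lim)
    moreover have "dist (qform (G n) x) (P n) + dist (qform (G n) x) (Q n) \<le> D n" for n
      using numerical_rangeI[OF x(1), of "G n"] unfolding W by simp
    ultimately have "dist z p + dist z q \<le> e" using LIMSEQ_le[OF _ lim(3)] by blast
    then show "z \<in> {z. dist z p + dist z q \<le> e}" by simp
  next
    fix z assume "z \<in> {z. dist z p + dist z q \<le> e}"
    then have z: "dist z p + dist z q \<le> e" by simp
    have "P n \<in> numerical_range (G n)" "Q n \<in> numerical_range (G n)" for n
      using lt[of n] by (simp_all add: W dist_commute)
    then have pq: "p \<in> numerical_range A" "q \<in> numerical_range A"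
      using numerical_range_limit[OF G lim(1)] numerical_range_limit[OF G lim(2)] by blast+
    show "z \<in> numerical_range A"
    proof (cases "dist p q = e")
      case True
      then have "dist p q = dist p z + dist z q"
        using z dist_triangle[of p q z] by (simp add: dist_commute)
      then have "z \<in> closed_segment p q" by (simp add: between flip: between_mem_segment)
      then show ?thesis using Toeplitz_Hausdorff pq unfolding convex_contains_segment by blast
    next
      case False
      \<comment> \<open>the interior points on the way from \<open>z\<close> to the focus \<open>p\<close>\<close>
      define y where "y s = (1 - s) *\<^sub>R z + s *\<^sub>R p" for s
      have y: "y s \<in> numerical_range A" if s: "0 < s" "s \<le> 1" for s
      proof -
        have "dist (y s) p = norm ((1 - s) *\<^sub>R (z - p))" by (simp add: dist_norm y_def algebra_simps)
        then have 1: "dist (y s) p = (1 - s) * dist z p" using s by (simp add: dist_norm)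
        have "dist (y s) q = norm ((1 - s) *\<^sub>R (z - q) + s *\<^sub>R (p - q))" by (simp add: dist_norm y_def algebra_simps)
        also have "\<dots> \<le> norm ((1 - s) *\<^sub>R (z - q)) + norm (s *\<^sub>R (p - q))" by (rule norm_triangle_ineq)
        also have "\<dots> = (1 - s) * dist z q + s * dist p q" using s by (simp add: dist_norm)
        finally have "dist (y s) p + dist (y s) q \<le> (1 - s) * (dist z p + dist z q) + s * dist p q"
          using 1 by (simp add: algebra_simps)
        also have "\<dots> \<le> (1 - s) * e + s * dist p q" using z s by (intro add_right_mono mult_left_mono) auto
        also have "s * dist p q < s * e" using False le s by simp
        finally have "dist (y s) p + dist (y s) q < e" by (simp add: algebra_simps)
        then have "0 < e - (dist (y s) p + dist (y s) q)" by simp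
        moreover have "(\<lambda>n. D n - (dist (y s) (P n) + dist (y s) (Q n))) \<longlonglongrightarrow> e - (dist (y s) p + dist (y s) q)"
          by (intro tendsto_intros lim)
        ultimately have "eventually (\<lambda>n. 0 < D n - (dist (y s) (P n) + dist (y s) (Q n))) sequentially"
          using order_tendstoD(1) by blast
        then obtain N where N: "\<And>n. n \<ge> N \<Longrightarrow> 0 < D n - (dist (y s) (P n) + dist (y s) (Q n))"
          unfolding eventually_sequentially by blast
        have "y s \<in> numerical_range (G (n + N))" for n using N[of "n + N"] by (simp add: W)
        then show ?thesis using numerical_range_limit[OF LIMSEQ_ignore_initial_segment[OF G] tendsto_const] by blast
      qed
      have "(\<lambda>n. y (inverse (real (Suc n)))) \<longlonglongrightarrow> (1 - 0) *\<^sub>R z + 0 *\<^sub>R p"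
        unfolding y_def by (intro tendsto_intros LIMSEQ_inverse_real_of_nat)
      then have lim_y: "(\<lambda>n. y (inverse (real (Suc n)))) \<longlonglongrightarrow> z" by simp
      have "y (inverse (real (Suc n))) \<in> numerical_range A" for n
        by (intro y) (simp_all add: inverse_le_1_iff)
      then show ?thesis
        using closed_sequentially[OF compact_imp_closed[OF compact_numerical_range] _ lim_y] by blast
    qed
  qed
  then show ?thesis using le by blast
qed

section \<open>Limits of matrices with a flat boundary portion\<close>

text \<open>The property of having an at least two-dimensional top eigenspace in some direction, with its witnesses
  explicit and normalised, so that it passes to limits by compactness.\<close>

definition double_support :: "complex^'n^'n \<Rightarrow> complex \<Rightarrow> complex^'n \<Rightarrow> complex^'n \<Rightarrow> bool" where
  "double_support A a u v \<longleftrightarrow> norm a = 1 \<and> norm u = 1 \<and> norm v = 1 \<and> cscalar_prod u v = 0 \<and>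
    herm_part a A u = of_real (2 * Re (a * qform A u)) *s u \<and>
    herm_part a A v = of_real (2 * Re (a * qform A u)) *s v \<and>
    (\<forall>y. norm y = 1 \<longrightarrow> Re (a * qform A y) \<le> Re (a * qform A u))"

text \<open>Unit vectors over two distinct points of a supporting line are linearly independent, because
  proportional unit vectors have the same value under \<open>q\<close>; one Gram-Schmidt step makes them
  orthonormal.\<close>

lemma F3_double_support:
  assumes "A \<in> F3"
  shows "\<exists>a u v. double_support A a u v"
proof -
  obtain b z1 z2 where b: "b \<noteq> 0" and z: "z1 \<in> numerical_range A" "z2 \<in> numerical_range A" "z1 \<noteq> z2"
      "Re (b * z1) = Re (b * z2)" "\<And>z. z \<in> numerical_range A \<Longrightarrow> Re (b * z) \<le> Re (b * z1)"
    using assms unfolding F3_iff by blast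
  define a where "a = sgn b"
  have Re_a: "Re (a * z) = Re (b * z) / norm b" for z
    by (simp add: a_def sgn_div_norm divide_inverse mult.commute del: times_complex.simps)
  obtain x1 x2 where x: "norm x1 = 1" "z1 = qform A x1" "norm x2 = 1" "z2 = qform A x2"
    using z by (auto simp: numerical_range_eq)
  define m where "m = Re (a * qform A x1)"
  have max: "Re (a * qform A y) \<le> m" if "norm y = 1" for y
    using z(5)[OF numerical_rangeI[OF that]] b unfolding m_def Re_a x(2) by (simp add: divide_right_mono del: times_complex.simps)
  have "Re (a * qform A x2) = m" unfolding m_def Re_a using z(4) x by simp
  then have H: "herm_part a A x1 = of_real (2 * m) *s x1" "herm_part a A x2 = of_real (2 * m) *s x2"
    using maximiser_eigenvector[OF max] x by (simp_all add: m_def del: times_complex.simps)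
  define c where "c = cscalar_prod x1 x2"
  define w where "w = x2 - c *s x1"
  have "w \<noteq> 0"
  proof
    assume "w = 0"
    then have "x2 = c *s x1" by (simp add: w_def)
    moreover have "norm c = 1" using calculation x by (simp add: norm_scale)
    ultimately show False using z(3) x by (simp add: qform_scale)
  qed
  define v where "v = complex_of_real (1 / norm w) *s w"
  have "herm_part a A w = of_real (2 * m) *s w"
    unfolding w_def herm_part_diff herm_part_scale H by (simp add: vec_eq_iff algebra_simps)
  then have Hv: "herm_part a A v = of_real (2 * m) *s v"
    unfolding v_def herm_part_scale by (simp add: mult.commute)
  have "cscalar_prod x1 w = 0" using x by (simp add: w_def c_def cscalar_prod_simps cscalar_prod_self)
  then have "cscalar_prod x1 v = 0" by (simp add: v_def cscalar_prod_simps)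
  moreover have "norm v = 1" using \<open>w \<noteq> 0\<close> by (simp add: v_def norm_scale norm_divide)
  moreover have "norm a = 1" using b by (simp add: a_def norm_sgn)
  ultimately have "double_support A a x1 v"
    unfolding double_support_def using x H(1) Hv max by (simp add: m_def del: times_complex.simps)
  then show ?thesis by blast
qed

text \<open>Directions and orthonormal pairs range over compact spheres, and the defining conditions are
  closed.\<close>

lemma closure_F3_double_support:
  assumes "A \<in> closure F3"
  shows "\<exists>a u v. double_support A a u v"
proof -
  obtain F where F: "\<And>n. F n \<in> F3" "F \<longlonglongrightarrow> A" using assms unfolding closure_sequential by blast
  have "\<forall>n. \<exists>t. double_support (F n) (fst t) (fst (snd t)) (snd (snd t))"
    using F3_double_support[OF F(1)] by (metis fst_conv snd_conv)
  from choice[OF this] obtain t where t: "\<And>n. double_support (F n) (fst (t n)) (fst (snd (t n))) (snd (snd (t n)))"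
    by blast
  have "t n \<in> sphere 0 1 \<times> sphere 0 1 \<times> sphere 0 1" for n
    using t[of n] by (simp add: double_support_def mem_Times_iff)
  moreover have "compact (sphere 0 1 \<times> sphere 0 1 \<times> sphere 0 1 :: (complex \<times> (complex^3) \<times> (complex^3)) set)"
    by (intro compact_Times compact_sphere)
  ultimately obtain l r where r: "strict_mono (r :: nat \<Rightarrow> nat)" "(t \<circ> r) \<longlonglongrightarrow> l"
    unfolding compact_def by blast
  obtain a u v where l: "l = (a, u, v)" by (metis prod_cases3)
  define a' u' v' where "a' n = fst (t (r n))" "u' n = fst (snd (t (r n)))" "v' n = snd (snd (t (r n)))" for n
  note defs = this
  have lim: "a' \<longlonglongrightarrow> a" "u' \<longlonglongrightarrow> u" "v' \<longlonglongrightarrow> v"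
    using tendsto_fst[OF r(2)] tendsto_fst[OF tendsto_snd[OF r(2)]] tendsto_snd[OF tendsto_snd[OF r(2)]]
    by (simp_all add: l defs[abs_def] o_def)
  define G where "G = F \<circ> r"
  have G: "G \<longlonglongrightarrow> A" unfolding G_def by (rule LIMSEQ_subseq_LIMSEQ[OF F(2) r(1)])
  have "double_support (G n) (a' n) (u' n) (v' n)" for n using t[of "r n"] by (simp add: G_def defs)
  then have ds: "norm (a' n) = 1" "norm (u' n) = 1" "norm (v' n) = 1" "cscalar_prod (u' n) (v' n) = 0"
      "herm_part (a' n) (G n) (u' n) = of_real (2 * Re (a' n * qform (G n) (u' n))) *s u' n"
      "herm_part (a' n) (G n) (v' n) = of_real (2 * Re (a' n * qform (G n) (u' n))) *s v' n"
      "norm y = 1 \<Longrightarrow> Re (a' n * qform (G n) y) \<le> Re (a' n * qform (G n) (u' n))" for n y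
    unfolding double_support_def by blast+
  note tl = tendsto_intros lim G
  have "norm a = 1" "norm u = 1" "norm v = 1" "cscalar_prod u v = 0"
    using LIMSEQ_unique[OF tendsto_norm[OF lim(1)]] LIMSEQ_unique[OF tendsto_norm[OF lim(2)]]
      LIMSEQ_unique[OF tendsto_norm[OF lim(3)]] LIMSEQ_unique[OF tendsto_cscalar_prod[OF lim(2,3)]]
    by (simp_all add: ds)
  moreover have "(\<lambda>n. of_real (2 * Re (a' n * qform (G n) (u' n))) *s u' n) \<longlonglongrightarrow> herm_part a A u"
    unfolding ds(5)[symmetric] herm_part_def by (intro tl)
  then have "herm_part a A u = of_real (2 * Re (a * qform A u)) *s u"
    by (rule LIMSEQ_unique) (intro tl)
  moreover have "(\<lambda>n. of_real (2 * Re (a' n * qform (G n) (u' n))) *s v' n) \<longlonglongrightarrow> herm_part a A v"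
    unfolding ds(6)[symmetric] herm_part_def by (intro tl)
  then have "herm_part a A v = of_real (2 * Re (a * qform A u)) *s v"
    by (rule LIMSEQ_unique) (intro tl)
  moreover have "Re (a * qform A y) \<le> Re (a * qform A u)" if "norm y = 1" for y
  proof (rule LIMSEQ_le)
    show "(\<lambda>n. Re (a' n * qform (G n) y)) \<longlonglongrightarrow> Re (a * qform A y)" by (intro tl)
    show "(\<lambda>n. Re (a' n * qform (G n) (u' n))) \<longlonglongrightarrow> Re (a * qform A u)" by (intro tl)
    show "\<exists>N. \<forall>n\<ge>N. Re (a' n * qform (G n) y) \<le> Re (a' n * qform (G n) (u' n))" using ds(7)[OF that] by blast
  qed
  ultimately show ?thesis unfolding double_support_def by blast
qed

text \<open>By strict convexity \<open>q\<close> has a constant value \<open>\<alpha>\<close> on the unit vectors of the span of \<open>u\<close> and \<open>v\<close>, so by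
  polarisation \<open>A - \<alpha>\<close> maps this span into the line orthogonal to it and hence kills a non-zero vector
  \<open>x\<close> of it. As \<open>x\<close> is also an eigenvector of \<open>a A + (a A)\<^sup>*\<close>, it is one of \<open>A\<^sup>*\<close>.\<close>

lemma double_support_normal_eigenvalue:
  fixes A :: "complex^3^3"
  assumes E: "is_ellipse (numerical_range A)" and ds: "double_support A a u v"
  shows "\<exists>\<alpha>. normal_eigenvalue A \<alpha> \<and> \<alpha> \<in> frontier (numerical_range A)"
proof -
  define \<alpha> where "\<alpha> = qform A u"
  define m where "m = Re (a * \<alpha>)"
  have "norm a = 1" and u: "norm u = 1" and v: "norm v = 1" and uv: "cscalar_prod u v = 0"
    and H: "herm_part a A u = of_real (2 * m) *s u" "herm_part a A v = of_real (2 * m) *s v"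
    and max: "\<And>y. norm y = 1 \<Longrightarrow> Re (a * qform A y) \<le> m"
    using ds unfolding double_support_def m_def \<alpha>_def by blast+
  then have "a \<noteq> 0" by auto
  have vu: "cscalar_prod v u = 0" by (rule cscalar_prod_0_commute[OF uv])
  have maxW: "Re (a * z) \<le> m" if "z \<in> numerical_range A" for z
    using that max by (auto simp: numerical_range_eq simp del: times_complex.simps)
  have \<alpha>W: "\<alpha> \<in> numerical_range A" unfolding \<alpha>_def by (rule numerical_rangeI[OF u])
  have Hcomb: "herm_part a A (c *s u + d *s v) = of_real (2 * m) *s (c *s u + d *s v)" for c d
    unfolding linear_add[OF herm_part_linear] herm_part_scale H
    by (simp add: vec_eq_iff algebra_simps)
  have norm_comb: "cscalar_prod (c *s u + d *s v) (c *s u + d *s v) = of_real ((norm c)\<^sup>2 + (norm d)\<^sup>2)" for c d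
    unfolding of_real_add complex_norm_square
    by (simp add: cscalar_prod_simps uv vu cscalar_prod_self_eq_1[THEN iffD2] u v)
  have q_const: "qform A x = \<alpha>" if x: "norm x = 1" "herm_part a A x = of_real (2 * m) *s x" for x
  proof -
    have "2 * Re (a * qform A x) = Re (cscalar_prod x (of_real (2 * m) *s x))"
      unfolding inner_herm_part[symmetric] x(2) Re_cscalar_prod ..
    also have "cscalar_prod x (of_real (2 * m) *s x) = of_real (2 * m)"
      using x(1) by (simp add: cscalar_prod_scale_right cscalar_prod_self)
    finally have "Re (a * qform A x) = m" by (simp only: Re_complex_of_real mult_cancel_left) simp
    moreover have "Re (a * \<alpha>) = m" by (simp only: m_def)
    ultimately show ?thesis
      using ellipse_maximiser_unique[OF E \<open>a \<noteq> 0\<close> numerical_rangeI[OF x(1)] \<alpha>W _ _ maxW] by blast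
  qed
  have qv: "qform A v = \<alpha>" using q_const[OF v H(2)] .
  define p q where "p = cscalar_prod u (A *v v)" "q = cscalar_prod v (A *v u)"
  \<comment> \<open>polarisation with the vectors \<open>u + c v\<close>\<close>
  have cross: "c * p + cnj c * q = 0" if "norm c = 1" for c
  proof -
    define x where "x = u + c *s v"
    have "cscalar_prod x x = of_real 2" using norm_comb[of 1 c] that by (simp add: x_def)
    then have n2: "(norm x)\<^sup>2 = 2" unfolding cscalar_prod_self of_real_eq_iff .
    then have "x \<noteq> 0" by auto
    then have unit: "norm (complex_of_real (1 / norm x) *s x) = 1" by (simp add: norm_scale norm_divide)
    have "herm_part a A x = of_real (2 * m) *s x" using Hcomb[of 1 c] by (simp add: x_def)
    then have "herm_part a A (complex_of_real (1 / norm x) *s x) = of_real (2 * m) *s (complex_of_real (1 / norm x) *s x)"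
      by (simp add: herm_part_scale mult.commute)
    then have "qform A (complex_of_real (1 / norm x) *s x) = \<alpha>" using q_const unit by blast
    then have "of_real ((norm (complex_of_real (1 / norm x)))\<^sup>2) * qform A x = \<alpha>" unfolding qform_scale .
    moreover have "(norm (complex_of_real (1 / norm x)))\<^sup>2 = 1 / 2" using n2 by (simp add: norm_divide power_divide)
    ultimately have "of_real (1 / 2) * qform A x = \<alpha>" by (simp only:)
    then have "qform A x = 2 * \<alpha>" by auto
    moreover have "qform A x = 2 * \<alpha> + (c * p + cnj c * q)"
      unfolding x_def qform_add qform_scale that p_q_def
      by (simp add: qv matrix_vector_mult_scale cscalar_prod_simps flip: \<alpha>_def)
    ultimately show ?thesis by simp
  qed
  have "p + q = 0" "\<i> * (p - q) = 0" using cross[of 1] cross[of \<i>] by (simp_all add: right_diff_distrib)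
  then have "p = 0" "q = 0" by (simp_all add: add_eq_0_iff2)
  obtain w where o: "orthonormal3 u v w" using orthonormal3_extend u v uv by blast
  define g h where "g = cscalar_prod w (A *v u)" "h = cscalar_prod w (A *v v)"
  obtain c d where cd: "c \<noteq> 0 \<or> d \<noteq> 0" "c * g + d * h = 0"
  proof (cases "h = 0")
    case True then show ?thesis using that[of 0 1] by simp
  next
    case False then show ?thesis using that[of h "- g"] by simp
  qed
  define x where "x = c *s u + d *s v"
  have "cscalar_prod x x \<noteq> 0"
    unfolding x_def norm_comb of_real_eq_0_iff using cd(1) by (simp add: add_nonneg_eq_0_iff)
  then have "x \<noteq> 0" by auto
  have Au: "cscalar_prod u (A *v u) = \<alpha>" "cscalar_prod v (A *v v) = \<alpha>" "cscalar_prod u (A *v v) = 0" "cscalar_prod v (A *v u) = 0"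
    using qv \<open>p = 0\<close> \<open>q = 0\<close> by (simp_all add: \<alpha>_def qform_def p_q_def)
  have Ax: "A *v x = c *s (A *v u) + d *s (A *v v)"
    by (simp add: x_def matrix_vector_right_distrib matrix_vector_mult_scale)
  have "cscalar_prod u (A *v x) = c * \<alpha>" "cscalar_prod v (A *v x) = d * \<alpha>" "cscalar_prod w (A *v x) = 0"
    unfolding Ax using cd(2) by (simp_all add: cscalar_prod_simps Au g_h_def)
  then have Ax': "A *v x = \<alpha> *s x"
    using orthonormal3_expand[OF o, of "A *v x"] by (simp add: x_def vec_eq_iff algebra_simps)
  have "a *s (\<alpha> *s x) + cnj a *s (herm_adjoint A *v x) = of_real (2 * m) *s x"
    using Hcomb[of c d] unfolding x_def[symmetric] herm_part_def Ax' .
  moreover have "of_real (2 * m) = a * \<alpha> + cnj a * cnj \<alpha>"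
    unfolding m_def using complex_add_cnj[of "a * \<alpha>"] by simp
  ultimately have "a *s (\<alpha> *s x) + cnj a *s (herm_adjoint A *v x) = (a * \<alpha> + cnj a * cnj \<alpha>) *s x"
    by (simp only:)
  then have "cnj a *s (herm_adjoint A *v x) = cnj a *s (cnj \<alpha> *s x)"
    by (simp add: vec_eq_iff algebra_simps)
  then have "herm_adjoint A *v x = cnj \<alpha> *s x" using \<open>a \<noteq> 0\<close> by (simp add: vec_eq_iff)
  then have "normal_eigenvalue A \<alpha>" using Ax' \<open>x \<noteq> 0\<close> by (auto simp: normal_eigenvalue_def)
  moreover have "\<alpha> \<in> frontier (numerical_range A)"
    using maximiser_in_frontier[OF \<open>a \<noteq> 0\<close> \<alpha>W] maxW unfolding m_def by blast
  ultimately show ?thesis by blast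
qed

section \<open>The intersection of the closures\<close>

theorem theorem5p6:
  shows "closure E3 \<inter> closure F3 =
    {A. unitarily_reducible A \<and>
        (is_point (numerical_range A) \<or> is_segment (numerical_range A) \<or>
         is_ellipse (numerical_range A) \<and> the_normal_eigenvalue A \<in> frontier (numerical_range A))}"
proof (intro set_eqI iffI)
  fix A assume A: "A \<in> closure E3 \<inter> closure F3"
  obtain f g d where d: "dist f g \<le> d" and W: "numerical_range A = {z. dist z f + dist z g \<le> d}"
    using closure_E3_numerical_range A by blast
  have "unitarily_reducible A \<and> (is_point (numerical_range A) \<or> is_segment (numerical_range A) \<or>
         is_ellipse (numerical_range A) \<and> the_normal_eigenvalue A \<in> frontier (numerical_range A))"
  proof (cases "dist f g = d")
    case True
    have "dist z f + dist z g \<le> d \<longleftrightarrow> dist f g = dist f z + dist z g" for z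
      using True dist_triangle[of f g z] by (auto simp: dist_commute)
    then have seg: "numerical_range A = closed_segment f g"
      unfolding W by (intro set_eqI) (simp only: mem_Collect_eq between between_mem_segment[symmetric])
    then have "is_point (numerical_range A) \<or> is_segment (numerical_range A)"
      unfolding is_point_def is_segment_def by (cases "f = g") auto
    then show ?thesis using segment_range_in_closures[OF seg] unitarily_reducible_iff by blast
  next
    case False
    then have E: "is_ellipse (numerical_range A)" using d W unfolding is_ellipse_def by (metis order_less_le)
    obtain a u v where "double_support A a u v" using closure_F3_double_support A by blast
    then obtain \<alpha> where \<alpha>: "normal_eigenvalue A \<alpha>" "\<alpha> \<in> frontier (numerical_range A)"
      using double_support_normal_eigenvalue[OF E] by blast
    then show ?thesis using E the_normal_eigenvalue_eq[OF E \<alpha>(1)] unitarily_reducible_iff by blast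
  qed
  then show "A \<in> {A. unitarily_reducible A \<and>
        (is_point (numerical_range A) \<or> is_segment (numerical_range A) \<or>
         is_ellipse (numerical_range A) \<and> the_normal_eigenvalue A \<in> frontier (numerical_range A))}" by simp
next
  fix A assume "A \<in> {A. unitarily_reducible A \<and>
        (is_point (numerical_range A) \<or> is_segment (numerical_range A) \<or>
         is_ellipse (numerical_range A) \<and> the_normal_eigenvalue A \<in> frontier (numerical_range A))}"
  then obtain \<alpha> where \<alpha>: "normal_eigenvalue A \<alpha>" and
    cases: "is_point (numerical_range A) \<or> is_segment (numerical_range A) \<or>
         is_ellipse (numerical_range A) \<and> the_normal_eigenvalue A \<in> frontier (numerical_range A)"
    by (auto simp: unitarily_reducible_iff)
  from cases show "A \<in> closure E3 \<inter> closure F3"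
  proof (elim disjE conjE)
    assume "is_point (numerical_range A)"
    then obtain p where "numerical_range A = closed_segment p p" by (auto simp: is_point_def)
    then show ?thesis using segment_range_in_closures by blast
  next
    assume "is_segment (numerical_range A)"
    then show ?thesis using segment_range_in_closures by (auto simp: is_segment_def)
  next
    assume "is_ellipse (numerical_range A)" "the_normal_eigenvalue A \<in> frontier (numerical_range A)"
    then show ?thesis using ellipse_frontier_in_closures the_normal_eigenvalue_eq \<alpha> by metis
  qed
qed

end
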